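(* Suppose $\gamma>0$ and $\rho>0$. Take $\lambda\in(0,1)$ and $\epsilon\in[0,1)$ with $\|K\|^2<4\gamma\rho(\lambda^{-1}-\epsilon)(\lambda^{-1}-1)$. For all $i\in\mathbb N$ set $$\tau_i:=\frac{\lambda^2}{2\gamma(1-\lambda)},\qquad \omega_i:=\frac{\lambda^{-1}-1}{\lambda^{-1}-\epsilon},\qquad \sigma_i:=\frac{\lambda^2}{2\rho(1-\lambda)},\qquad \mu_i:=\lambda_i:=\lambda.$$ Then the iterates $u^N=(x^N,y^N)$ generated by the IC-PDPS algorithm (defined in the context) and the associated auxiliary sequence $\{z^N\}$ satisfy both $\mathcal G_{\gamma,\rho}(u^N;\widehat u)\to0$ and $\|z^N-\widehat u\|^2\to0$ at a linear rate for (the unique) $\widehat u=(\widehat x,\widehat y)\in H^{-1}(0)$.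
   Context: $X,Y$ are (real) Hilbert spaces, $K\in\mathcal L(X;Y)$ is bounded linear, $G:X\to[-\infty,\infty]$ and $F^*:Y\to[-\infty,\infty]$ are convex, proper, lower semicontinuous, and (strongly) convex with factors $\gamma\ge0$ and $\rho\ge0$ respectively (i.e. $G-\frac\gamma2\|\cdot\|^2$ and $F^*-\frac\rho2\|\cdot\|^2$ are convex). $F^*$ is the Fenchel conjugate of a convex, proper, lower semicontinuous $F$. The set $H^{-1}(0)$ consists of the pairs $\widehat u=(\widehat x,\widehat y)\in X\times Y$ with $-K^*\widehat y\in\partial G(\widehat x)$ and $K\widehat x\in\partial F^*(\widehat y)$. $\mathbb N=\{0,1,2,\dots\}$. "Linear rate" means bounded by $Cq^N$ for some constants $C\ge0$ and $q\in(0,1)$. The proximal map is $\operatorname{prox}_{tG}(v):=\arg\min_x\, tG(x)+\frac12\|x-v\|^2$, i.e. $(I+t\partial G)^{-1}(v)$. IC-PDPS algorithm (inertial, corrected, primal-dual proximal splitting), for given parameters $(\tau_i,\sigma_{i+1},\lambda_i,\mu_{i+1},\omega_i)_{i\in\mathbb N}$: take arbitrary $\tilde x^0:=\bar x^0:=x^0\in X$ and $\tilde y^0:=\bar y^0:=y^0\in\operatorname{dom}\partial F^*$, and for $i=0,1,2,\dots$ set $\tilde\tau_i:=\tau_i/[1+\gamma\tau_i(\lambda_i^{-1}-1)]$, $\tilde\sigma_{i+1}:=\sigma_{i+1}/[1+\rho\sigma_{i+1}(\mu_{i+1}^{-1}-1)]$, $x^i_\gamma:=[\bar x^i+\gamma\tau_i(\lambda_i^{-1}-1)x^i]/[1+\gamma\tau_i(\lambda_i^{-1}-1)]$,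 $x^{i+1}:=\operatorname{prox}_{\tilde\tau_iG}(x^i_\gamma-\tilde\tau_iK^*\tilde y^i)$, $\bar x^{i+1}:=x^{i+1}+\lambda_{i+1}(\lambda_i^{-1}-1)(x^{i+1}-x^i)$, $\tilde x^{i+1}:=x^{i+1}+(\lambda_i^{-1}-1)(x^{i+1}-x^i)$, $y^i_\rho:=[\bar y^i+\rho\sigma_{i+1}(\mu_{i+1}^{-1}-1)y^i]/[1+\rho\sigma_{i+1}(\mu_{i+1}^{-1}-1)]$, $y^{i+1}:=\operatorname{prox}_{\tilde\sigma_{i+1}F^*}(y^i_\rho+\tilde\sigma_{i+1}K[\tilde x^{i+1}+\omega_i(\tilde x^{i+1}-\tilde x^i)])$, $\bar y^{i+1}:=y^{i+1}+\mu_{i+2}(\mu_{i+1}^{-1}-1)(y^{i+1}-y^i)$, $\tilde y^{i+1}:=y^{i+1}+(\mu_{i+1}^{-1}-1)(y^{i+1}-y^i)$. The auxiliary sequence is $z^i=(\zeta^i,\eta^i)$ with $\zeta^0:=x^0$, $\eta^0:=y^0$, $\zeta^{i+1}:=\lambda_i^{-1}x^{i+1}-(\lambda_i^{-1}-1)x^i$, $\eta^{i+1}:=\mu_{i+1}^{-1}y^{i+1}-(\mu_{i+1}^{-1}-1)y^i$. With $G_\gamma(x;\widehat x):=G(x)-\frac\gamma2\|x-\widehat x\|^2$ and $(F^* )_\rho(y;\widehat y):=F^*(y)-\frac\rho2\|y-\widehat y\|^2$, the strong convexity adjusted gap is $$\mathcal G_{\gamma,\rho}(x,y;\widehat x,\widehat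 y):=\bigl(G_\gamma(x;\widehat x)+\langle\widehat y,Kx\rangle-(F^* )_\rho(\widehat y;\widehat y)\bigr)-\bigl(G_\gamma(\widehat x;\widehat x)+\langle y,K\widehat x\rangle-(F^* )_\rho(y;\widehat y)\bigr).$$ *)

theory Defs
  imports "HOL-Analysis.Analysis"
begin

section \<open>Extended-real-valued convex analysis on Hilbert spaces\<close>

text \<open>On \<^typ>\<open>ereal\<close> one has \<open>\<infinity> + (-\<infinity>) = \<infinity>\<close>, so the inequality below is convexity of the
  epigraph also for functions that take the value \<open>-\<infinity>\<close>.\<close>

definition convex_fun :: "('a::real_vector \<Rightarrow> ereal) \<Rightarrow> bool" where
  "convex_fun f \<longleftrightarrow>
     (\<forall>x y. \<forall>t\<in>{0<..<1}. f ((1 - t) *\<^sub>R x + t *\<^sub>R y) \<le> ereal (1 - t) * f x + ereal t * f y)"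

definition proper_fun :: "('a \<Rightarrow> ereal) \<Rightarrow> bool" where
  "proper_fun f \<longleftrightarrow> (\<forall>x. f x \<noteq> -\<infinity>) \<and> (\<exists>x. f x \<noteq> \<infinity>)"

definition lsc_fun :: "('a::topological_space \<Rightarrow> ereal) \<Rightarrow> bool" where
  "lsc_fun f \<longleftrightarrow> (\<forall>x. f x \<le> Liminf (at x) f)"

definition strongly_convex_fun :: "real \<Rightarrow> ('a::real_inner \<Rightarrow> ereal) \<Rightarrow> bool" where
  "strongly_convex_fun \<gamma> f \<longleftrightarrow> convex_fun (\<lambda>x. f x - ereal (\<gamma> / 2 * (norm x)\<^sup>2))"

definition fenchel_conjugate :: "('a::real_inner \<Rightarrow> ereal) \<Rightarrow> 'a \<Rightarrow> ereal" where
  "fenchel_conjugate f y = (SUP x. ereal (y \<bullet> x) - f x)"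

definition subdiff :: "('a::real_inner \<Rightarrow> ereal) \<Rightarrow> 'a \<Rightarrow> 'a set" where
  "subdiff f x = {p. \<bar>f x\<bar> \<noteq> \<infinity> \<and> (\<forall>z. f x + ereal (p \<bullet> (z - x)) \<le> f z)}"

definition prox :: "real \<Rightarrow> ('a::real_inner \<Rightarrow> ereal) \<Rightarrow> 'a \<Rightarrow> 'a" where
  "prox t f v = arg_min (\<lambda>x. ereal t * f x + ereal (1 / 2 * (norm (x - v))\<^sup>2)) (\<lambda>_. True)"

section \<open>The saddle-point problem\<close>

text \<open>The constant \<^const>\<open>adjoint\<close> is a Hilbert choice; for a bounded linear map between
  Hilbert spaces it is the usual (existing and unique) Hilbert-space adjoint.\<close>

definition solution_set ::
  "('a::real_inner \<Rightarrow> ereal) \<Rightarrow> ('b::real_inner \<Rightarrow> ereal) \<Rightarrow> ('a \<Rightarrow>\<^sub>L 'b) \<Rightarrow> ('a \<times> 'b) set" where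
  "solution_set G Fstar K =
     {(x, y). - adjoint (blinfun_apply K) y \<in> subdiff G x \<and> blinfun_apply K x \<in> subdiff Fstar y}"

definition adjusted :: "real \<Rightarrow> ('a::real_inner \<Rightarrow> ereal) \<Rightarrow> 'a \<Rightarrow> 'a \<Rightarrow> ereal" where
  "adjusted \<gamma> f x xh = f x - ereal (\<gamma> / 2 * (norm (x - xh))\<^sup>2)"

definition adjusted_gap ::
  "('a::real_inner \<Rightarrow> ereal) \<Rightarrow> ('b::real_inner \<Rightarrow> ereal) \<Rightarrow> ('a \<Rightarrow>\<^sub>L 'b) \<Rightarrow> real \<Rightarrow> real
    \<Rightarrow> 'a \<times> 'b \<Rightarrow> 'a \<times> 'b \<Rightarrow> ereal" where
  "adjusted_gap G Fstar K \<gamma> \<rho> = (\<lambda>(x, y) (xh, yh).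
     (adjusted \<gamma> G x xh + ereal (yh \<bullet> blinfun_apply K x) - adjusted \<rho> Fstar yh yh)
     - (adjusted \<gamma> G xh xh + ereal (y \<bullet> blinfun_apply K xh) - adjusted \<rho> Fstar y yh))"

section \<open>The inertial, corrected, primal-dual proximal splitting\<close>

text \<open>In the following two definitions \<open>xb\<close>, \<open>xt\<close> (and \<open>yb\<close>, \<open>yt\<close>) are the barred and tilded
  sequences. The parameters \<open>\<sigma> 0\<close> and \<open>\<mu> 0\<close> are not used.\<close>

definition ic_pdps ::
  "('a::real_inner \<Rightarrow> ereal) \<Rightarrow> ('b::real_inner \<Rightarrow> ereal) \<Rightarrow> ('a \<Rightarrow>\<^sub>L 'b) \<Rightarrow> real \<Rightarrow> real
    \<Rightarrow> (nat \<Rightarrow> real) \<Rightarrow> (nat \<Rightarrow> real) \<Rightarrow> (nat \<Rightarrow> real) \<Rightarrow> (nat \<Rightarrow> real) \<Rightarrow> (nat \<Rightarrow> real)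
    \<Rightarrow> (nat \<Rightarrow> 'a) \<Rightarrow> (nat \<Rightarrow> 'a) \<Rightarrow> (nat \<Rightarrow> 'a)
    \<Rightarrow> (nat \<Rightarrow> 'b) \<Rightarrow> (nat \<Rightarrow> 'b) \<Rightarrow> (nat \<Rightarrow> 'b) \<Rightarrow> bool" where
  "ic_pdps G Fstar K \<gamma> \<rho> \<tau> \<sigma> lam \<mu> \<omega> x xb xt y yb yt \<longleftrightarrow>
     xt 0 = x 0 \<and> xb 0 = x 0 \<and> yt 0 = y 0 \<and> yb 0 = y 0 \<and> subdiff Fstar (y 0) \<noteq> {} \<and>
     (\<forall>i.
       let a = \<gamma> * \<tau> i * (inverse (lam i) - 1);
           b = \<rho> * \<sigma> (i+1) * (inverse (\<mu> (i+1)) - 1);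
           \<tau>t = \<tau> i / (1 + a);
           \<sigma>t = \<sigma> (i+1) / (1 + b);
           x\<gamma> = (xb i + a *\<^sub>R x i) /\<^sub>R (1 + a);
           y\<rho> = (yb i + b *\<^sub>R y i) /\<^sub>R (1 + b)
       in x (i+1) = prox \<tau>t G (x\<gamma> - \<tau>t *\<^sub>R adjoint (blinfun_apply K) (yt i)) \<and>
          xb (i+1) = x (i+1) + (lam (i+1) * (inverse (lam i) - 1)) *\<^sub>R (x (i+1) - x i) \<and>
          xt (i+1) = x (i+1) + (inverse (lam i) - 1) *\<^sub>R (x (i+1) - x i) \<and>
          y (i+1) = prox \<sigma>t Fstar
            (y\<rho> + \<sigma>t *\<^sub>R blinfun_apply K (xt (i+1) + \<omega> i *\<^sub>R (xt (i+1) - xt i))) \<and>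
          yb (i+1) = y (i+1) + (\<mu> (i+2) * (inverse (\<mu> (i+1)) - 1)) *\<^sub>R (y (i+1) - y i) \<and>
          yt (i+1) = y (i+1) + (inverse (\<mu> (i+1)) - 1) *\<^sub>R (y (i+1) - y i))"

definition auxiliary_sequence ::
  "(nat \<Rightarrow> real) \<Rightarrow> (nat \<Rightarrow> real) \<Rightarrow> (nat \<Rightarrow> 'a::real_inner) \<Rightarrow> (nat \<Rightarrow> 'b::real_inner)
    \<Rightarrow> (nat \<Rightarrow> 'a \<times> 'b) \<Rightarrow> bool" where
  "auxiliary_sequence lam \<mu> x y z \<longleftrightarrow>
     z 0 = (x 0, y 0) \<and>
     (\<forall>i. z (i+1) = (inverse (lam i) *\<^sub>R x (i+1) - (inverse (lam i) - 1) *\<^sub>R x i,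
                     inverse (\<mu> (i+1)) *\<^sub>R y (i+1) - (inverse (\<mu> (i+1)) - 1) *\<^sub>R y i))"

text \<open>The index set \<open>I\<close> serves to leave out the starting index when the adjusted gap there is
  \<open>\<infinity>\<close>, which happens exactly if the starting point \<open>x 0\<close> is outside the domain of \<open>G\<close>.\<close>

definition vanishes_linearly_on :: "nat set \<Rightarrow> (nat \<Rightarrow> ereal) \<Rightarrow> bool" where
  "vanishes_linearly_on I a \<longleftrightarrow>
     (\<exists>C\<ge>0. \<exists>q\<in>{0<..<1}. \<forall>N\<in>I. \<bar>a N\<bar> \<le> ereal (C * q ^ N))"

end

theory Submission
  imports Defs
begin

text \<open>Both prox inclusions are tested against the solution and against the previous iterate. With
  \<open>\<kappa> = 1/\<lambda> - 1\<close>, \<open>(Z, W)\<close> the difference of the auxiliary point and the solution, and \<open>e\<close>, \<open>e*\<close> the Bregman-type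
  excesses of \<open>G\<close> and \<open>F*\<close> at the iterate, whose sum is the adjusted gap, the function
  \<open>V = \<gamma> \<kappa> \<parallel>Z\<parallel>\<^sup>2 + \<theta> \<rho> \<kappa> \<parallel>W\<parallel>\<^sup>2 - \<langle>K Z, W\<rangle> + \<kappa> e + \<theta> \<kappa> e*\<close> with \<open>\<theta> = 1/\<omega> > 1\<close> then
  decreases by the factor \<open>\<omega>\<close> in each step. The bound on \<open>\<parallel>K\<parallel>\<close> is exactly coercivity of its quadratic part.
  The solution is obtained by minimising \<open>G + H \<circ> K\<close>, where \<open>H\<close> is the conjugate of \<open>F*\<close>, which is
  smooth since \<open>F*\<close> is strongly convex.\<close>

section \<open>Strongly convex functions on a convex domain\<close>

text \<open>Real values on an explicit domain replace extended ones, so that later arithmetic stays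
  in the reals. The modulus \<open>c = 0\<close> is plain convexity.\<close>

definition strongly_convex_on :: "real \<Rightarrow> 'a::real_inner set \<Rightarrow> ('a \<Rightarrow> real) \<Rightarrow> bool" where
  "strongly_convex_on c D g \<longleftrightarrow> convex D \<and>
     (\<forall>x\<in>D. \<forall>y\<in>D. \<forall>t\<in>{0<..<1}. g ((1 - t) *\<^sub>R x + t *\<^sub>R y)
        \<le> (1 - t) * g x + t * g y - c / 2 * (t * (1 - t)) * (norm (x - y))\<^sup>2)"

text \<open>Its closedness expresses lower semicontinuity of the extension of \<open>g\<close> by
  \<open>\<infinity>\<close> outside \<open>D\<close>, without asking \<open>D\<close> itself to be
  closed.\<close>

definition epigraph_on :: "'a set \<Rightarrow> ('a \<Rightarrow> real) \<Rightarrow> ('a \<times> real) set" where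
  "epigraph_on D g = {(x, r). x \<in> D \<and> g x \<le> r}"

lemma strongly_convex_onD:
  assumes "strongly_convex_on c D g" "x \<in> D" "y \<in> D" "0 < t" "t < 1"
  shows "(1 - t) *\<^sub>R x + t *\<^sub>R y \<in> D"
    and "g ((1 - t) *\<^sub>R x + t *\<^sub>R y)
        \<le> (1 - t) * g x + t * g y - c / 2 * (t * (1 - t)) * (norm (x - y))\<^sup>2"
proof -
  have "convex D" using assms(1) by (simp add: strongly_convex_on_def)
  then show "(1 - t) *\<^sub>R x + t *\<^sub>R y \<in> D"
    using assms by (auto intro: convexD)
qed (use assms in \<open>auto simp: strongly_convex_on_def\<close>)

lemma norm_convex_combination:
  fixes x y :: "'a::real_inner"
  shows "(norm ((1 - t) *\<^sub>R x + t *\<^sub>R y))\<^sup>2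
    = (1 - t) * (norm x)\<^sup>2 + t * (norm y)\<^sup>2 - t * (1 - t) * (norm (x - y))\<^sup>2"
  by (simp add: power2_norm_eq_inner inner_simps inner_commute[of y x] algebra_simps)

lemma strongly_convex_on_norm:
  fixes v :: "'a::real_inner"
  shows "strongly_convex_on 1 UNIV (\<lambda>x. 1 / 2 * (norm (x - v))\<^sup>2)"
  unfolding strongly_convex_on_def
proof (intro conjI ballI)
  fix x y :: 'a and t :: real
  have e: "(1 - t) *\<^sub>R x + t *\<^sub>R y - v = (1 - t) *\<^sub>R (x - v) + t *\<^sub>R (y - v)"
    by (simp add: algebra_simps)
  show "1 / 2 * (norm ((1 - t) *\<^sub>R x + t *\<^sub>R y - v))\<^sup>2
    \<le> (1 - t) * (1 / 2 * (norm (x - v))\<^sup>2) + t * (1 / 2 * (norm (y - v))\<^sup>2)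
        - 1 / 2 * (t * (1 - t)) * (norm (x - y))\<^sup>2"
    unfolding e norm_convex_combination by (simp add: field_simps)
qed auto

lemma strongly_convex_on_linear:
  "linear (h :: 'a::real_inner \<Rightarrow> real) \<Longrightarrow> strongly_convex_on 0 UNIV h"
  by (simp add: strongly_convex_on_def linear_add linear_scale)

lemma strongly_convex_on_add:
  assumes "strongly_convex_on c D g" "strongly_convex_on d UNIV h"
  shows "strongly_convex_on (c + d) D (\<lambda>x. g x + h x)"
  unfolding strongly_convex_on_def
proof (intro conjI ballI)
  show "convex D" using assms(1) by (simp add: strongly_convex_on_def)
  fix x y and t :: real assume "x \<in> D" "y \<in> D" "t \<in> {0<..<1}"
  then show "g ((1 - t) *\<^sub>R x + t *\<^sub>R y) + h ((1 - t) *\<^sub>R x + t *\<^sub>R y)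
      \<le> (1 - t) * (g x + h x) + t * (g y + h y) - (c + d) / 2 * (t * (1 - t)) * (norm (x - y))\<^sup>2"
    using strongly_convex_onD(2)[OF assms(1), of x y t] strongly_convex_onD(2)[OF assms(2), of x y t]
    by (simp add: algebra_simps add_divide_distrib)
qed

lemma strongly_convex_on_cmult:
  assumes "strongly_convex_on c D g" "0 \<le> s"
  shows "strongly_convex_on (s * c) D (\<lambda>x. s * g x)"
  unfolding strongly_convex_on_def
proof (intro conjI ballI)
  show "convex D" using assms(1) by (simp add: strongly_convex_on_def)
  fix x y and t :: real assume "x \<in> D" "y \<in> D" "t \<in> {0<..<1}"
  then show "s * g ((1 - t) *\<^sub>R x + t *\<^sub>R y)
      \<le> (1 - t) * (s * g x) + t * (s * g y) - s * c / 2 * (t * (1 - t)) * (norm (x - y))\<^sup>2"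
    using mult_left_mono[OF strongly_convex_onD(2)[OF assms(1), of x y t] assms(2)]
    by (simp add: algebra_simps)
qed

lemma closed_epigraph_add:
  assumes "closed (epigraph_on D g)" "continuous_on UNIV h"
  shows "closed (epigraph_on D (\<lambda>x. g x + h x))"
proof -
  have "continuous_on UNIV (\<lambda>(x, r). (x, r - h x))"
    unfolding case_prod_unfold
    by (intro continuous_intros continuous_on_compose2[OF assms(2)]) auto
  then have "closed ((\<lambda>(x, r). (x, r - h x)) -` epigraph_on D g)"
    by (intro closed_vimage assms(1))
  also have "(\<lambda>(x, r). (x, r - h x)) -` epigraph_on D g = epigraph_on D (\<lambda>x. g x + h x)"
    by (auto simp: epigraph_on_def)
  finally show ?thesis .
qed

lemma closed_epigraph_cmult:
  assumes "closed (epigraph_on D g)" "0 < s"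
  shows "closed (epigraph_on D (\<lambda>x. s * g x))"
proof -
  have "continuous_on UNIV (\<lambda>(x :: 'a, r). (x, r / s))"
    unfolding case_prod_unfold by (intro continuous_intros) (use assms in auto)
  then have "closed ((\<lambda>(x, r). (x, r / s)) -` epigraph_on D g)"
    by (intro closed_vimage assms(1))
  also have "(\<lambda>(x, r). (x, r / s)) -` epigraph_on D g = epigraph_on D (\<lambda>x. s * g x)"
    using assms(2) by (auto simp: epigraph_on_def field_simps)
  finally show ?thesis .
qed

text \<open>Convexity turns a minimum up to a second-order error into a minimum: divide by \<open>t\<close> and
  let \<open>t \<rightarrow> 0\<close> along the segment.\<close>

lemma quadratic_growth:
  assumes g: "strongly_convex_on c D g" and p: "p \<in> D"
    and min: "\<And>x. x \<in> D \<Longrightarrow> g p \<le> g x + C * (norm (x - p))\<^sup>2" and x: "x \<in> D"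
  shows "g p + c / 2 * (norm (x - p))\<^sup>2 \<le> g x"
proof -
  let ?d = "(norm (x - p))\<^sup>2"
  have ev: "\<forall>\<^sub>F t in at_right 0. g p + c / 2 * (1 - t) * ?d - C * t * ?d \<le> g x"
  proof (rule eventually_at_rightI[of 0 1])
    fix t :: real assume t: "t \<in> {0<..<1}"
    define w where "w = (1 - t) *\<^sub>R p + t *\<^sub>R x"
    have "w - p = t *\<^sub>R (x - p)" by (simp add: w_def algebra_simps)
    then have nw: "(norm (w - p))\<^sup>2 = t\<^sup>2 * ?d" by (simp add: power_mult_distrib)
    have "g p \<le> g w + C * (t\<^sup>2 * ?d)"
      using min[of w] strongly_convex_onD(1)[OF g p x, of t] t nw by (auto simp: w_def)
    also have "\<dots> \<le> (1 - t) * g p + t * g x - c / 2 * (t * (1 - t)) * ?d + C * (t\<^sup>2 * ?d)"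
      using strongly_convex_onD(2)[OF g p x, of t] t by (auto simp: w_def norm_minus_commute)
    finally have "t * (g p + c / 2 * (1 - t) * ?d - C * t * ?d) \<le> t * g x"
      by (simp add: algebra_simps power2_eq_square)
    then show "g p + c / 2 * (1 - t) * ?d - C * t * ?d \<le> g x"
      using t by simp
  qed auto
  have "((\<lambda>t. g p + c / 2 * (1 - t) * ?d - C * t * ?d) \<longlongrightarrow>
      g p + c / 2 * (1 - 0) * ?d - C * 0 * ?d) (at_right 0)"
    by (intro tendsto_intros)
  from tendsto_upperbound[OF this ev] show ?thesis by simp
qed

text \<open>Near \<open>a\<close> the function exceeds \<open>g a - 1\<close> by closedness; strong convexity propagates
  this along rays, so no affine minorant (Hahn--Banach) is needed.\<close>

lemma strongly_convex_bdd_below: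
  assumes g: "strongly_convex_on c D g" and c: "0 < c" and cl: "closed (epigraph_on D g)"
    and a: "a \<in> D"
  shows "\<exists>m. \<forall>x\<in>D. m \<le> g x"
proof -
  have "open (- epigraph_on D g)" "(a, g a - 1) \<in> - epigraph_on D g"
    using cl by (auto simp: epigraph_on_def)
  then obtain r where r: "0 < r" and rb: "ball (a, g a - 1) r \<subseteq> - epigraph_on D g"
    by (auto simp: open_contains_ball)
  have near: "g a - 1 \<le> g u" if "u \<in> D" "norm (u - a) < r" for u
  proof -
    have "(u, g a - 1) \<in> ball (a, g a - 1) r"
      using that by (simp add: dist_Pair_Pair dist_norm norm_minus_commute)
    then have "(u, g a - 1) \<notin> epigraph_on D g" using rb by blast
    then show ?thesis using that by (auto simp: epigraph_on_def)
  qed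
  have "min (g a - 1) (g a - 4 / (c * r\<^sup>2)) \<le> g x" if x: "x \<in> D" for x
  proof (cases "norm (x - a) < r")
    case True
    then show ?thesis using near[OF x] by simp
  next
    case False
    define d where "d = norm (x - a)"
    have d: "r \<le> d" "0 < d" using False r by (auto simp: d_def)
    \<comment> \<open>The point \<open>u\<close> below then has distance \<open>r / 2\<close> from
      \<open>a\<close>, where the local bound applies, and \<open>t \<le> 1 / 2\<close> keeps
      \<open>1 - t\<close> away from 0.\<close>
    define t where "t = r / (2 * d)"
    have t: "0 < t" "t \<le> 1 / 2" "t < 1" using d r by (auto simp: t_def field_simps)
    define u where "u = (1 - t) *\<^sub>R a + t *\<^sub>R x"
    have "u - a = t *\<^sub>R (x - a)" by (simp add: u_def algebra_simps)
    then have "norm (u - a) = r / 2" using t d r by (simp add: d_def[symmetric]) (simp add: t_def)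
    then have "g a - 1 \<le> g u"
      using near[of u] strongly_convex_onD(1)[OF g a x t(1,3)] r by (auto simp: u_def)
    also have "g u \<le> (1 - t) * g a + t * g x - c / 2 * (t * (1 - t)) * d\<^sup>2"
      using strongly_convex_onD(2)[OF g a x t(1,3)] by (simp add: u_def d_def norm_minus_commute)
    finally have "t * (g a + c / 2 * (1 - t) * d\<^sup>2) - 1 \<le> t * g x"
      by (simp add: algebra_simps)
    then have "t * (g a + c / 2 * (1 - t) * d\<^sup>2 - 1 / t) \<le> t * g x"
      using t by (simp add: algebra_simps)
    then have *: "g a + c / 2 * (1 - t) * d\<^sup>2 - 1 / t \<le> g x"
      using t by simp
    have "c / 2 * (1 / 2) * d\<^sup>2 \<le> c / 2 * (1 - t) * d\<^sup>2"
      using t c by (intro mult_right_mono mult_left_mono) auto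
    \<comment> \<open>Completing the square bounds the quadratic term minus \<open>1 / t\<close>
      from below, uniformly in the distance \<open>d\<close>.\<close>
    moreover have "0 \<le> (c * d / 2 - 2 / r)\<^sup>2 / c" using c by simp
    moreover have "(c * d / 2 - 2 / r)\<^sup>2 / c = c / 4 * d\<^sup>2 - 2 * d / r + 4 / (c * r\<^sup>2)"
      using c r by (simp add: power2_eq_square field_simps)
    moreover have "1 / t = 2 * d / r" using d r by (simp add: t_def)
    ultimately have "g a - 4 / (c * r\<^sup>2) \<le> g x" using * by simp
    then show ?thesis by simp
  qed
  then show ?thesis by blast
qed

text \<open>A minimising sequence is Cauchy by strong convexity at midpoints; its limit attains the
  infimum because the epigraph is closed.\<close>

lemma strongly_convex_minimum:
  fixes g :: "'a::{real_inner,complete_space} \<Rightarrow> real"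
  assumes g: "strongly_convex_on c D g" and c: "0 < c" and cl: "closed (epigraph_on D g)"
    and ne: "D \<noteq> {}"
  obtains p where "p \<in> D" "\<And>x. x \<in> D \<Longrightarrow> g p + c / 2 * (norm (x - p))\<^sup>2 \<le> g x"
proof -
  obtain a where a: "a \<in> D" using ne by auto
  obtain b where b: "\<And>x. x \<in> D \<Longrightarrow> b \<le> g x"
    using strongly_convex_bdd_below[OF g c cl a] by blast
  define m where "m = Inf (g ` D)"
  have m: "m \<le> g x" if "x \<in> D" for x
    unfolding m_def using that b by (intro cInf_lower bdd_belowI[of _ b]) auto
  have "\<exists>x\<in>D. g x < m + 1 / real (Suc n)" for n
  proof -
    have "Inf (g ` D) < m + 1 / real (Suc n)" by (simp add: m_def)
    then show ?thesis using cInf_lessD[of "g ` D"] ne by blast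
  qed
  then obtain X where X: "\<And>n. X n \<in> D" "\<And>n. g (X n) < m + 1 / real (Suc n)" by metis
  \<comment> \<open>The value at the midpoint is at least \<open>m\<close>, so strong convexity
    bounds the distance by the deviations from the infimum.\<close>
  have mid: "c / 8 * (norm (u - v))\<^sup>2 \<le> (g u - m) / 2 + (g v - m) / 2" if "u \<in> D" "v \<in> D" for u v
    using strongly_convex_onD[OF g that, of "1 / 2"] m[of "(1 - 1/2) *\<^sub>R u + (1/2) *\<^sub>R v"]
    by (simp add: field_simps)
  have "Cauchy X"
  proof (rule CauchyI)
    fix e :: real assume e: "0 < e"
    obtain N where N: "1 / real (Suc N) < c / 8 * e\<^sup>2"
      using nat_approx_posE[of "c / 8 * e\<^sup>2"] c e by auto
    have "norm (X k - X n) < e" if "N \<le> k" "N \<le> n" for k n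
    proof -
      have near: "g (X j) < m + c / 8 * e\<^sup>2" if "N \<le> j" for j
      proof -
        have "1 / real (Suc j) \<le> 1 / real (Suc N)"
          using that by (intro divide_left_mono) auto
        with X(2)[of j] N show ?thesis by linarith
      qed
      have "c / 8 * (norm (X k - X n))\<^sup>2 \<le> (g (X k) - m) / 2 + (g (X n) - m) / 2"
        by (rule mid) (rule X)+
      also have "\<dots> < c / 8 * e\<^sup>2"
        using near[OF that(1)] near[OF that(2)] by argo
      finally have "c / 8 * (norm (X k - X n))\<^sup>2 < c / 8 * e\<^sup>2" .
      then have "(norm (X k - X n))\<^sup>2 < e\<^sup>2" using c by simp
      then show ?thesis using e by (simp add: power2_less_imp_less)
    qed
    then show "\<exists>M. \<forall>k\<ge>M. \<forall>n\<ge>M. norm (X k - X n) < e" by blast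
  qed
  then obtain p where p: "X \<longlonglongrightarrow> p" by (auto simp: Cauchy_convergent_iff convergent_def)
  have "(\<lambda>n. m + 1 / real (Suc n)) \<longlonglongrightarrow> m + 0"
    by (intro tendsto_add tendsto_const LIMSEQ_Suc[OF lim_1_over_n])
  then have "(\<lambda>n. (X n, m + 1 / real (Suc n))) \<longlonglongrightarrow> (p, m)"
    using p by (auto intro!: tendsto_Pair)
  moreover have "(X n, m + 1 / real (Suc n)) \<in> epigraph_on D g" for n
    using X(1)[of n] X(2)[of n] by (simp add: epigraph_on_def)
  ultimately have "(p, m) \<in> epigraph_on D g"
    using closed_sequentially[OF cl, of "\<lambda>n. (X n, m + 1 / real (Suc n))"] by blast
  then have pD: "p \<in> D" and gp: "g p \<le> m" by (auto simp: epigraph_on_def)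
  have "g p + c / 2 * (norm (x - p))\<^sup>2 \<le> g x" if "x \<in> D" for x
    using quadratic_growth[OF g pD _ that, of 0] gp m by force
  with pD show thesis by (rule that)
qed

text \<open>Riesz representation: the minimiser of \<open>1 / 2 * (norm x)\<^sup>2 - h x\<close>
  represents \<open>h\<close>.\<close>

lemma continuous_linear_functional_representation:
  fixes h :: "'a::{real_inner,complete_space} \<Rightarrow> real"
  assumes "bounded_linear h"
  obtains p where "\<And>x. h x = x \<bullet> p"
proof -
  interpret h: bounded_linear h by fact
  have lin: "linear (\<lambda>x. - h x)" using assms bounded_linear.linear bounded_linear_minus by blast
  have sc: "strongly_convex_on 1 UNIV (\<lambda>x. 1 / 2 * (norm (x - 0))\<^sup>2 + - h x)"
    using strongly_convex_on_add[OF strongly_convex_on_norm[of 0] strongly_convex_on_linear[OF lin]] by simp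
  have "closed (epigraph_on UNIV (\<lambda>x::'a. (0::real)))"
  proof -
    have "epigraph_on UNIV (\<lambda>x::'a. (0::real)) = UNIV \<times> {0..}" by (auto simp: epigraph_on_def)
    then show ?thesis by (simp add: closed_Times)
  qed
  then have "closed (epigraph_on UNIV (\<lambda>x. 0 + (1 / 2 * (norm (x - 0))\<^sup>2 + - h x)))"
    by (rule closed_epigraph_add) (intro continuous_intros h.continuous_on)
  then have cl: "closed (epigraph_on UNIV (\<lambda>x. 1 / 2 * (norm (x - 0))\<^sup>2 + - h x))"
    by (simp only: add_0_left)
  obtain p where p: "\<And>x. 1 / 2 * (norm p)\<^sup>2 - h p + 1 / 2 * (norm (x - p))\<^sup>2 \<le> 1 / 2 * (norm x)\<^sup>2 - h x"
    using strongly_convex_minimum[OF sc _ cl] by auto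
  \<comment> \<open>The growth term cancels the quadratic part of the objective exactly, which
    leaves a linear inequality; applied to \<open>- v\<close> it gives equality.\<close>
  have *: "h v \<le> p \<bullet> v" for v
    using p[of "p + v"] by (simp add: h.add power2_norm_eq_inner inner_simps inner_commute field_simps)
  have "h v = v \<bullet> p" for v
    using *[of v] *[of "- v"] by (simp add: linear_neg[OF h.linear] inner_commute)
  then show thesis by (rule that)
qed

text \<open>The Riesz representation supplies a witness for the Hilbert choice in
  \<open>adjoint\<close>, so the chosen map has the defining property.\<close>

lemma inner_adjoint_blinfun:
  fixes K :: "'a::{real_inner,complete_space} \<Rightarrow>\<^sub>L 'b::real_inner"
  shows "blinfun_apply K x \<bullet> y = x \<bullet> adjoint (blinfun_apply K) y"
proof -
  have "\<exists>p. \<forall>x. blinfun_apply K x \<bullet> y = x \<bullet> p" for y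
    using continuous_linear_functional_representation[of "\<lambda>x. blinfun_apply K x \<bullet> y"]
      bounded_linear_inner_left_comp[OF blinfun.bounded_linear_right] by metis
  then have "\<exists>f'. \<forall>x y. blinfun_apply K x \<bullet> y = x \<bullet> f' y" by metis
  then show ?thesis unfolding adjoint_def by (rule someI2_ex) auto
qed

section \<open>Subgradients, proximal maps and saddle points\<close>

text \<open>At infinite values \<open>real_of_ereal\<close> returns the default 0, so it is always
  paired with this domain.\<close>

abbreviation finite_dom :: "('a \<Rightarrow> ereal) \<Rightarrow> 'a set" where
  "finite_dom f \<equiv> {x. \<bar>f x\<bar> \<noteq> \<infinity>}"

lemma strongly_convex_on_real_of_ereal:
  fixes f :: "'a::real_inner \<Rightarrow> ereal"
  assumes "strongly_convex_fun c f" and fin: "\<And>x. f x \<noteq> -\<infinity>"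
  shows "strongly_convex_on c (finite_dom f) (\<lambda>x. real_of_ereal (f x))"
proof -
  have main: "\<bar>f ((1 - t) *\<^sub>R x + t *\<^sub>R y)\<bar> \<noteq> \<infinity> \<and>
      real_of_ereal (f ((1 - t) *\<^sub>R x + t *\<^sub>R y)) \<le> (1 - t) * real_of_ereal (f x)
        + t * real_of_ereal (f y) - c / 2 * (t * (1 - t)) * (norm (x - y))\<^sup>2"
    if xy: "\<bar>f x\<bar> \<noteq> \<infinity>" "\<bar>f y\<bar> \<noteq> \<infinity>" and t: "t \<in> {0<..<1}" for x y t
  proof -
    obtain a b where ab: "f x = ereal a" "f y = ereal b" using xy by (auto simp: ereal_infinity_cases)
    let ?w = "(1 - t) *\<^sub>R x + t *\<^sub>R y"
    have *: "f ?w - ereal (c / 2 * (norm ?w)\<^sup>2) \<le>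
        ereal (1 - t) * (f x - ereal (c / 2 * (norm x)\<^sup>2)) + ereal t * (f y - ereal (c / 2 * (norm y)\<^sup>2))"
      using assms(1) t unfolding strongly_convex_fun_def convex_fun_def by blast
    \<comment> \<open>The right side of the inequality is finite and \<open>-\<infinity>\<close> is
      excluded, so the value at \<open>?w\<close> is finite. This is also what makes the domain
      convex.\<close>
    then obtain r where r: "f ?w = ereal r"
      using fin[of ?w] by (cases "f ?w") (auto simp: ab)
    from * have "r - c / 2 * (norm ?w)\<^sup>2 \<le>
        (1 - t) * (a - c / 2 * (norm x)\<^sup>2) + t * (b - c / 2 * (norm y)\<^sup>2)"
      by (simp add: ab r)
    then have "r \<le> (1 - t) * a + t * b - c / 2 * (t * (1 - t)) * (norm (x - y))\<^sup>2"
      unfolding norm_convex_combination by (simp add: field_simps)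
    then show ?thesis by (simp add: ab r)
  qed
  have "convex (finite_dom f)"
    unfolding convex_alt
  proof (intro ballI allI impI)
    fix x y and u :: real
    assume "x \<in> finite_dom f" "y \<in> finite_dom f" "0 \<le> u \<and> u \<le> 1"
    then show "(1 - u) *\<^sub>R x + u *\<^sub>R y \<in> finite_dom f"
      using main[of x y u] by (cases "u = 0 \<or> u = 1") auto
  qed
  with main show ?thesis by (simp add: strongly_convex_on_def)
qed

lemma epigraph_on_real_of_ereal:
  assumes "\<And>x. f x \<noteq> -\<infinity>"
  shows "epigraph_on (finite_dom f) (\<lambda>x. real_of_ereal (f x)) = {(x, r). f x \<le> ereal r}"
proof -
  have "(\<bar>f x\<bar> \<noteq> \<infinity> \<and> real_of_ereal (f x) \<le> r) = (f x \<le> ereal r)" for x r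
    using assms[of x] by (cases "f x") auto
  then show ?thesis by (simp add: epigraph_on_def)
qed

lemma closed_epigraph_lsc:
  fixes f :: "'a::real_inner \<Rightarrow> ereal"
  assumes "lsc_fun f"
  shows "closed {(x, r). f x \<le> ereal r}"
  unfolding closed_def open_prod_def
proof (intro ballI)
  fix q assume "q \<in> - {(x, r). f x \<le> ereal r}"
  then obtain x r where q: "q = (x, r)" "ereal r < f x" by (cases q) auto
  obtain s where s: "ereal r < ereal s" "ereal s < f x"
    using q(2) ereal_dense2 by blast
  have "ereal s < Liminf (at x) f"
    using s(2) assms unfolding lsc_fun_def by (meson less_le_trans)
  then have "\<forall>\<^sub>F u in at x. ereal s < f u" by (rule less_LiminfD)
  then obtain U where U: "open U" "x \<in> U" "\<And>u. u \<in> U \<Longrightarrow> u \<noteq> x \<Longrightarrow> ereal s < f u"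
    unfolding eventually_at_topological by auto
  have "U \<times> {..<s} \<subseteq> - {(x, r). f x \<le> ereal r}"
  proof clarify
    fix u v assume "u \<in> U" "v < s" "f u \<le> ereal v"
    \<comment> \<open>The filter \<open>at x\<close> is punctured, so the centre \<open>x\<close> is
      covered separately by the choice of \<open>s\<close>.\<close>
    moreover have "ereal s < f u" using U(3)[OF \<open>u \<in> U\<close>] s(2) by (cases "u = x") auto
    ultimately show False by (metis ereal_less_eq(3) less_le_trans not_less order.asym)
  qed
  with U s(1) q(1) show "\<exists>A B. open A \<and> open B \<and> q \<in> A \<times> B \<and> A \<times> B \<subseteq> - {(x, r). f x \<le> ereal r}"
    by (intro exI[of _ U] exI[of _ "{..<s}"]) auto
qed

text \<open>The epigraph is an intersection of closed half-spaces, one for each point where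
  \<open>F\<close> is finite; the other points impose no condition.\<close>

lemma closed_epigraph_fenchel_conjugate:
  fixes F :: "'a::real_inner \<Rightarrow> ereal"
  assumes "\<And>x. F x \<noteq> -\<infinity>"
  shows "closed {(y, r). fenchel_conjugate F y \<le> ereal r}"
proof -
  have "{(y, r). fenchel_conjugate F y \<le> ereal r} = (\<Inter>x. {(y, r). ereal (y \<bullet> x) - F x \<le> ereal r})"
    by (auto simp: fenchel_conjugate_def SUP_le_iff)
  moreover have "closed {(y, r). ereal (y \<bullet> x) - F x \<le> ereal r}" for x
  proof (cases "F x")
    case (real a)
    have "closed {p :: 'a \<times> real. fst p \<bullet> x - a \<le> snd p}"
      by (intro closed_Collect_le continuous_intros)
    with real show ?thesis by (simp add: case_prod_unfold)
  qed (use assms in auto)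
  ultimately show ?thesis by (auto intro: closed_INT)
qed

lemma fenchel_conjugate_neq_MInfty:
  assumes "proper_fun F"
  shows "fenchel_conjugate F y \<noteq> -\<infinity>"
proof -
  obtain x a where x: "F x = ereal a"
    using assms unfolding proper_fun_def by (metis ereal_cases)
  have "ereal (y \<bullet> x) - F x \<le> fenchel_conjugate F y"
    unfolding fenchel_conjugate_def by (rule SUP_upper) simp
  then show ?thesis by (auto simp: x)
qed

text \<open>The subgradient inequality with the quadratic gain built in; for strongly convex
  \<open>g\<close> it is equivalent to the ordinary one.\<close>

definition subgradient_on ::
  "real \<Rightarrow> 'a::real_inner set \<Rightarrow> ('a \<Rightarrow> real) \<Rightarrow> 'a \<Rightarrow> 'a \<Rightarrow> bool" where
  "subgradient_on c D g p q \<longleftrightarrow>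
     p \<in> D \<and> (\<forall>x\<in>D. g p + q \<bullet> (x - p) + c / 2 * (norm (x - p))\<^sup>2 \<le> g x)"

text \<open>Subtracting the linear functional given by \<open>q\<close> reduces this to quadratic
  growth at a minimum. The admissible error \<open>C\<close> later allows a smooth term to be
  replaced by its linearisation.\<close>

lemma subgradient_on_quadratic:
  assumes sc: "strongly_convex_on c D g" and p: "p \<in> D"
    and sub: "\<And>x. x \<in> D \<Longrightarrow> g p + q \<bullet> (x - p) \<le> g x + C * (norm (x - p))\<^sup>2"
  shows "subgradient_on c D g p q"
proof -
  have "linear (\<lambda>x. - (q \<bullet> x))" by (rule linearI) (simp_all add: inner_simps)
  from strongly_convex_on_add[OF sc strongly_convex_on_linear[OF this]]
  have sc': "strongly_convex_on c D (\<lambda>x. g x + - (q \<bullet> x))" by simp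
  have "g p + q \<bullet> (x - p) + c / 2 * (norm (x - p))\<^sup>2 \<le> g x" if "x \<in> D" for x
  proof -
    have "g p + - (q \<bullet> p) + c / 2 * (norm (x - p))\<^sup>2 \<le> g x + - (q \<bullet> x)"
      by (rule quadratic_growth[OF sc' p _ that, of C])
        (use sub in \<open>force simp: inner_diff_right\<close>)
    then show ?thesis by (simp add: inner_diff_right)
  qed
  with p show ?thesis by (simp add: subgradient_on_def)
qed

lemma mem_subdiff_iff:
  assumes sc: "strongly_convex_on c (finite_dom f) (\<lambda>x. real_of_ereal (f x))" and c: "0 \<le> c"
    and fin: "\<And>x. f x \<noteq> -\<infinity>"
  shows "q \<in> subdiff f p \<longleftrightarrow> subgradient_on c (finite_dom f) (\<lambda>x. real_of_ereal (f x)) p q"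
proof
  assume q: "q \<in> subdiff f p"
  show "subgradient_on c (finite_dom f) (\<lambda>x. real_of_ereal (f x)) p q"
  proof (rule subgradient_on_quadratic[OF sc, of _ _ 0])
    show "p \<in> finite_dom f" using q by (simp add: subdiff_def)
    fix x assume x: "x \<in> finite_dom f"
    have "f p + ereal (q \<bullet> (x - p)) \<le> f x" "\<bar>f p\<bar> \<noteq> \<infinity>" using q by (auto simp: subdiff_def)
    with x show "real_of_ereal (f p) + q \<bullet> (x - p) \<le> real_of_ereal (f x) + 0 * (norm (x - p))\<^sup>2"
      by (cases "f p"; cases "f x") auto
  qed
next
  assume q: "subgradient_on c (finite_dom f) (\<lambda>x. real_of_ereal (f x)) p q"
  have "f p + ereal (q \<bullet> (x - p)) \<le> f x" for x
  proof (cases "f x = \<infinity>")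
    case False
    with fin[of x] have x: "\<bar>f x\<bar> \<noteq> \<infinity>" by auto
    then have "real_of_ereal (f p) + q \<bullet> (x - p) + c / 2 * (norm (x - p))\<^sup>2 \<le> real_of_ereal (f x)"
      "\<bar>f p\<bar> \<noteq> \<infinity>"
      using q by (auto simp: subgradient_on_def)
    moreover have "0 \<le> c / 2 * (norm (x - p))\<^sup>2" using c by simp
    ultimately show ?thesis using x by (cases "f p"; cases "f x") auto
  qed simp
  with q show "q \<in> subdiff f p" by (auto simp: subdiff_def subgradient_on_def)
qed

text \<open>The objective is strongly convex with modulus \<open>t * c + 1\<close>, so a minimiser
  exists and is the one picked by the Hilbert choice. Quadratic growth around it contains the
  subgradient inequality.\<close>

lemma prox_subgradient_on:
  fixes f :: "'a::{real_inner,complete_space} \<Rightarrow> ereal"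
  assumes sc: "strongly_convex_on c (finite_dom f) (\<lambda>x. real_of_ereal (f x))" and c: "0 \<le> c"
    and cl: "closed (epigraph_on (finite_dom f) (\<lambda>x. real_of_ereal (f x)))"
    and fin: "\<And>x. f x \<noteq> -\<infinity>" and ne: "finite_dom f \<noteq> {}" and t: "0 < t"
  shows "subgradient_on c (finite_dom f) (\<lambda>x. real_of_ereal (f x)) (prox t f v) ((v - prox t f v) /\<^sub>R t)"
proof -
  let ?g = "\<lambda>x. real_of_ereal (f x)" and ?D = "finite_dom f"
  let ?h = "\<lambda>x. t * ?g x + 1 / 2 * (norm (x - v))\<^sup>2"
  let ?\<phi> = "\<lambda>x. ereal t * f x + ereal (1 / 2 * (norm (x - v))\<^sup>2)"
  have sch: "strongly_convex_on (t * c + 1) ?D ?h"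
    using t by (intro strongly_convex_on_add strongly_convex_on_cmult sc strongly_convex_on_norm) auto
  have clh: "closed (epigraph_on ?D ?h)"
    using t by (intro closed_epigraph_add closed_epigraph_cmult cl) (auto intro!: continuous_intros)
  have pos: "0 < t * c + 1" using t c by (simp add: add_nonneg_pos)
  obtain p where p: "p \<in> ?D"
    and min: "\<And>x. x \<in> ?D \<Longrightarrow> ?h p + (t * c + 1) / 2 * (norm (x - p))\<^sup>2 \<le> ?h x"
    using strongly_convex_minimum[OF sch pos clh ne] by blast
  \<comment> \<open>Since \<open>0 < t\<close>, the objective is infinite exactly off
    \<open>?D\<close>, so minimising over the whole space and over \<open>?D\<close> agree.\<close>
  have \<phi>: "?\<phi> x = (if x \<in> ?D then ereal (?h x) else \<infinity>)" for x
    using fin[of x] t by (cases "f x") auto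
  have "?\<phi> p \<le> ?\<phi> x" for x
  proof (cases "x \<in> ?D")
    case True
    have "0 \<le> (t * c + 1) / 2 * (norm (x - p))\<^sup>2" using pos by simp
    then have "?h p \<le> ?h x" using min[OF True] by linarith
    then show ?thesis using True p unfolding \<phi> by simp
  next
    case False
    then show ?thesis unfolding \<phi>[of x] by simp
  qed
  then have ex: "is_arg_min ?\<phi> (\<lambda>_. True) p" by (simp add: is_arg_min_linorder)
  have "is_arg_min ?\<phi> (\<lambda>_. True) (prox t f v)"
    unfolding prox_def arg_min_def by (rule someI[of _ p]) (rule ex)
  then have le: "?\<phi> (prox t f v) \<le> ?\<phi> p" by (simp add: is_arg_min_linorder)
  have D: "prox t f v \<in> ?D"
  proof (rule ccontr)
    assume "prox t f v \<notin> ?D"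
    then show False using le p unfolding \<phi>[of "prox t f v"] \<phi>[of p] by simp
  qed
  then have "?h (prox t f v) \<le> ?h p"
    using le p unfolding \<phi> by simp
  with min[OF D] have "(t * c + 1) / 2 * (norm (prox t f v - p))\<^sup>2 \<le> 0" by linarith
  with pos have "prox t f v = p" by (simp add: mult_le_0_iff)
  show ?thesis unfolding \<open>prox t f v = p\<close> subgradient_on_def
  proof (intro conjI ballI p)
    fix x assume "x \<in> ?D"
    \<comment> \<open>This three-point identity uses up the summand 1 of the modulus
      \<open>t * c + 1\<close>.\<close>
    have "1 / 2 * (norm (x - v))\<^sup>2 - 1 / 2 * (norm (p - v))\<^sup>2 - 1 / 2 * (norm (x - p))\<^sup>2 = (p - v) \<bullet> (x - p)"
      by (simp add: power2_norm_eq_inner inner_simps inner_commute field_simps)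
    with min[OF \<open>x \<in> ?D\<close>] have "t * ?g p + (v - p) \<bullet> (x - p) + t * c / 2 * (norm (x - p))\<^sup>2 \<le> t * ?g x"
      by (simp add: field_simps inner_diff_left)
    moreover have e: "t * (((v - p) /\<^sub>R t) \<bullet> (x - p)) = (v - p) \<bullet> (x - p)"
      using t by simp
    ultimately have "t * (?g p + ((v - p) /\<^sub>R t) \<bullet> (x - p) + c / 2 * (norm (x - p))\<^sup>2) \<le> t * ?g x"
      unfolding distrib_left e by (simp add: mult.assoc)
    then show "?g p + ((v - p) /\<^sub>R t) \<bullet> (x - p) + c / 2 * (norm (x - p))\<^sup>2 \<le> ?g x"
      using t by simp
  qed
qed

text \<open>The point \<open>y u\<close> attains the conjugate of \<open>f\<close> at \<open>u\<close> and is its gradient there; strong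
  convexity of \<open>f\<close> bounds the linearisation error of the conjugate.\<close>

lemma strongly_convex_conjugate:
  fixes f :: "'b::{real_inner,complete_space} \<Rightarrow> real"
  assumes sc: "strongly_convex_on r E f" and r: "0 < r"
    and cl: "closed (epigraph_on E f)" and ne: "E \<noteq> {}"
  obtains H y where "\<And>u. subgradient_on r E f (y u) u"
    "\<And>u v. H u + (v - u) \<bullet> y u \<le> H v"
    "\<And>u v. H v \<le> H u + (v - u) \<bullet> y u + (norm (v - u))\<^sup>2 / (2 * r)"
proof -
  have "\<exists>p. subgradient_on r E f p u" for u
  proof -
    have "linear (\<lambda>y. - (u \<bullet> y))" by (rule linearI) (simp_all add: inner_simps)
    from strongly_convex_on_add[OF sc strongly_convex_on_linear[OF this]]
    have sc': "strongly_convex_on r E (\<lambda>y. f y + - (u \<bullet> y))" by simp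
    have cl': "closed (epigraph_on E (\<lambda>y. f y + - (u \<bullet> y)))"
      by (intro closed_epigraph_add cl continuous_intros)
    obtain p where "p \<in> E"
      and "\<And>y. y \<in> E \<Longrightarrow> f p + - (u \<bullet> p) + r / 2 * (norm (y - p))\<^sup>2 \<le> f y + - (u \<bullet> y)"
      using strongly_convex_minimum[OF sc' r cl' ne] by blast
    then have "subgradient_on r E f p u"
      by (auto simp: subgradient_on_def inner_diff_right algebra_simps)
    then show ?thesis ..
  qed
  then obtain y where y: "\<And>u. subgradient_on r E f (y u) u" by metis
  \<comment> \<open>Nonnegativity of the left side is Young's inequality, which trades the gain from
    strong convexity for the factor \<open>1 / (2 * r)\<close>.\<close>
  have sq: "(norm (a - r *\<^sub>R b))\<^sup>2 / (2 * r) = (norm a)\<^sup>2 / (2 * r) - a \<bullet> b + r / 2 * (norm b)\<^sup>2"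
    for a b :: 'b
    using r by (simp add: power2_norm_eq_inner inner_simps inner_commute[of b a] field_simps)
  \<comment> \<open>The conjugate of \<open>f\<close>, evaluated at its maximiser.\<close>
  define H where "H u = u \<bullet> y u - f (y u)" for u
  have *: "f (y u) + u \<bullet> (y v - y u) + r / 2 * (norm (y v - y u))\<^sup>2 \<le> f (y v)" for u v
    using y[of u] y[of v] by (simp add: subgradient_on_def)
  have "H u + (v - u) \<bullet> y u \<le> H v" for u v
  proof -
    have "0 \<le> r / 2 * (norm (y u - y v))\<^sup>2" using r by simp
    then show ?thesis using *[of v u] by (simp add: H_def inner_simps)
  qed
  moreover have "H v \<le> H u + (v - u) \<bullet> y u + (norm (v - u))\<^sup>2 / (2 * r)" for u v
  proof -
    have "0 \<le> (norm (v - u - r *\<^sub>R (y v - y u)))\<^sup>2 / (2 * r)" using r by simp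
    also have "\<dots> = (norm (v - u))\<^sup>2 / (2 * r) - (v - u) \<bullet> (y v - y u) + r / 2 * (norm (y v - y u))\<^sup>2"
      by (rule sq)
    finally show ?thesis using *[of u v] by (simp add: H_def inner_simps)
  qed
  ultimately show thesis using y that by blast
qed

text \<open>The dual point is the gradient at \<open>K p\<close> of the conjugate \<open>H\<close>,
  where \<open>p\<close> minimises \<open>g + H \<circ> K\<close>. Its own subgradient condition is
  then immediate, and only the one for \<open>g\<close> needs work.\<close>

lemma saddle_point_exists:
  fixes g :: "'a::{real_inner,complete_space} \<Rightarrow> real" and f :: "'b::{real_inner,complete_space} \<Rightarrow> real"
    and K :: "'a \<Rightarrow>\<^sub>L 'b"
  assumes g: "strongly_convex_on c D g" "0 < c" "closed (epigraph_on D g)" "D \<noteq> {}"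
    and f: "strongly_convex_on r E f" "0 < r" "closed (epigraph_on E f)" "E \<noteq> {}"
  obtains p q where "subgradient_on c D g p (- adjoint (blinfun_apply K) q)"
    "subgradient_on r E f q (blinfun_apply K p)"
proof -
  obtain H y where y: "\<And>u. subgradient_on r E f (y u) u"
    and lo: "\<And>u v. H u + (v - u) \<bullet> y u \<le> H v"
    and up: "\<And>u v. H v \<le> H u + (v - u) \<bullet> y u + (norm (v - u))\<^sup>2 / (2 * r)"
    using strongly_convex_conjugate[OF f] by metis
  \<comment> \<open>\<open>H\<close> is squeezed between its affine minorant and its quadratic
    majorant at \<open>u\<close>.\<close>
  have "isCont H u" for u
    unfolding isCont_def
  proof (rule real_tendsto_sandwich)
    have "((\<lambda>v. H u + (v - u) \<bullet> y u) \<longlongrightarrow> H u + (u - u) \<bullet> y u) (at u)"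
      by (intro tendsto_intros)
    then show "((\<lambda>v. H u + (v - u) \<bullet> y u) \<longlongrightarrow> H u) (at u)" by simp
    have "((\<lambda>v. H u + (v - u) \<bullet> y u + (norm (v - u))\<^sup>2 / (2 * r)) \<longlongrightarrow>
        H u + (u - u) \<bullet> y u + (norm (u - u))\<^sup>2 / (2 * r)) (at u)"
      using f(2) by (intro tendsto_intros) auto
    then show "((\<lambda>v. H u + (v - u) \<bullet> y u + (norm (v - u))\<^sup>2 / (2 * r)) \<longlongrightarrow> H u) (at u)" by simp
  qed (use lo up in auto)
  then have contH: "continuous_on UNIV H" by (simp add: continuous_at_imp_continuous_on)
  let ?h = "\<lambda>x. H (blinfun_apply K x)"
  have cont: "continuous_on UNIV ?h"
    by (intro continuous_on_compose2[OF contH] continuous_intros) auto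
  have "strongly_convex_on 0 UNIV ?h"
    unfolding strongly_convex_on_def
  proof (intro conjI ballI)
    fix x1 x2 :: 'a and t :: real assume t: "t \<in> {0<..<1}"
    let ?w = "(1 - t) *\<^sub>R x1 + t *\<^sub>R x2"
    let ?y = "y (blinfun_apply K ?w)"
    have "blinfun_apply K x1 - blinfun_apply K ?w = t *\<^sub>R (blinfun_apply K x1 - blinfun_apply K x2)"
      "blinfun_apply K x2 - blinfun_apply K ?w = - ((1 - t) *\<^sub>R (blinfun_apply K x1 - blinfun_apply K x2))"
      by (simp_all add: blinfun.bilinear_simps algebra_simps)
    with lo[of "blinfun_apply K ?w" "blinfun_apply K x1"] lo[of "blinfun_apply K ?w" "blinfun_apply K x2"]
    have "?h ?w + t * ((blinfun_apply K x1 - blinfun_apply K x2) \<bullet> ?y) \<le> ?h x1"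
      "?h ?w - (1 - t) * ((blinfun_apply K x1 - blinfun_apply K x2) \<bullet> ?y) \<le> ?h x2"
      by simp_all
    \<comment> \<open>Weighting the two tangent inequalities at \<open>?w\<close> by
      \<open>1 - t\<close> and \<open>t\<close> cancels the slopes.\<close>
    then have "(1 - t) * (?h ?w + t * ((blinfun_apply K x1 - blinfun_apply K x2) \<bullet> ?y))
        + t * (?h ?w - (1 - t) * ((blinfun_apply K x1 - blinfun_apply K x2) \<bullet> ?y))
        \<le> (1 - t) * ?h x1 + t * ?h x2"
      using t by (intro add_mono mult_left_mono) auto
    then show "?h ?w \<le> (1 - t) * ?h x1 + t * ?h x2 - 0 / 2 * (t * (1 - t)) * (norm (x1 - x2))\<^sup>2"
      by (simp add: algebra_simps)
  qed auto
  from strongly_convex_on_add[OF g(1) this]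
  have sc: "strongly_convex_on c D (\<lambda>x. g x + ?h x)" by simp
  obtain p where p: "p \<in> D"
    and min: "\<And>x. x \<in> D \<Longrightarrow> g p + ?h p + c / 2 * (norm (x - p))\<^sup>2 \<le> g x + ?h x"
    using strongly_convex_minimum[OF sc g(2) closed_epigraph_add[OF g(3) cont] g(4)] by blast
  let ?q = "y (blinfun_apply K p)"
  \<comment> \<open>Minimality of \<open>p\<close> with \<open>H\<close> replaced by its
    linearisation at \<open>K p\<close>; the error is quadratic in \<open>x - p\<close>.\<close>
  have "g p + (- adjoint (blinfun_apply K) ?q) \<bullet> (x - p) \<le> g x + (norm K)\<^sup>2 / (2 * r) * (norm (x - p))\<^sup>2"
    if "x \<in> D" for x
  proof -
    have "(norm (blinfun_apply K (x - p)))\<^sup>2 \<le> (norm K * norm (x - p))\<^sup>2"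
      by (intro power_mono norm_blinfun) auto
    then have "(norm (blinfun_apply K (x - p)))\<^sup>2 / (2 * r) \<le> (norm K)\<^sup>2 / (2 * r) * (norm (x - p))\<^sup>2"
      using f(2) by (simp add: power_mult_distrib divide_right_mono)
    moreover have "(blinfun_apply K x - blinfun_apply K p) \<bullet> ?q = adjoint (blinfun_apply K) ?q \<bullet> (x - p)"
      using inner_adjoint_blinfun[of K "x - p" ?q] by (simp add: blinfun.diff_right inner_commute)
    moreover have "0 \<le> c / 2 * (norm (x - p))\<^sup>2" using g(2) by simp
    ultimately show ?thesis
      using min[OF that] up[of "blinfun_apply K x" "blinfun_apply K p"]
      by (simp add: blinfun.diff_right)
  qed
  from subgradient_on_quadratic[OF g(1) p this] y show thesis by (intro that)
qed

section \<open>The Lyapunov estimate\<close>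

text \<open>The Bregman distance of \<open>g\<close> between \<open>u\<close> and \<open>p\<close>
  along \<open>q\<close>, less the strong convexity term.\<close>

definition excess :: "real \<Rightarrow> ('a::real_inner \<Rightarrow> real) \<Rightarrow> 'a \<Rightarrow> 'a \<Rightarrow> 'a \<Rightarrow> real" where
  "excess c g p q u = g u - g p - q \<bullet> (u - p) - c / 2 * (norm (u - p))\<^sup>2"

lemma excess_nonneg: "subgradient_on c D g p q \<Longrightarrow> u \<in> D \<Longrightarrow> 0 \<le> excess c g p q u"
  by (force simp: subgradient_on_def excess_def)

text \<open>Testing the inclusion for the new iterate \<open>x'\<close> against the solution \<open>p\<close> with weight
  \<open>1\<close> and against the old iterate \<open>x\<close> with weight \<open>1/l - 1\<close> produces the auxiliary point \<open>\<zeta>'\<close>.\<close>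

lemma inertial_prox_step:
  fixes x x' \<zeta> \<zeta>' p q w :: "'a::real_inner"
  assumes c: "0 < c" and l: "0 < l" "l < 1" and k: "k = inverse l - 1"
    and \<tau>: "\<tau> = l\<^sup>2 / (2 * c * (1 - l))" and a: "a = c * \<tau> * k" and \<tau>t: "\<tau>t = \<tau> / (1 + a)"
    and xb: "xb = l *\<^sub>R \<zeta> + (1 - l) *\<^sub>R x" and \<zeta>': "\<zeta>' = inverse l *\<^sub>R x' - k *\<^sub>R x"
    and v: "v = (xb + a *\<^sub>R x) /\<^sub>R (1 + a) - \<tau>t *\<^sub>R w"
    and sub: "subgradient_on c D g x' ((v - x') /\<^sub>R \<tau>t)"
    and p: "p \<in> D" and x: "x \<in> D"
  shows "c * k * ((norm (\<zeta>' - p))\<^sup>2 + (norm (\<zeta>' - \<zeta>))\<^sup>2 - (norm (\<zeta> - p))\<^sup>2) + c * (norm (\<zeta>' - p))\<^sup>2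
    + (w + q) \<bullet> (\<zeta>' - p) + (k + 1) * excess c g p q x' \<le> k * excess c g p q x"
proof -
  have k0: "0 < k" using l by (simp add: k one_less_inverse)
  have \<tau>0: "0 < \<tau>" using c l by (simp add: \<tau>)
  have a0: "0 < 1 + a" using c k0 \<tau>0 by (simp add: a add_pos_pos)
  \<comment> \<open>The step length is chosen so that the prox residual has coefficient
    \<open>2 * c * k\<close> on \<open>\<zeta> - \<zeta>'\<close>; the factor 2 is consumed by a
    three-point identity below.\<close>
  have it: "inverse \<tau> * l = 2 * c * k" "inverse \<tau> * a = c * k"
    using c l by (simp_all add: \<tau> a k power2_eq_square field_simps)
  have l\<zeta>': "x' = l *\<^sub>R \<zeta>' + (1 - l) *\<^sub>R x"
    using l by (simp add: \<zeta>' k algebra_simps)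
  have "(v - x') /\<^sub>R \<tau>t = inverse \<tau> *\<^sub>R (xb + a *\<^sub>R x - (1 + a) *\<^sub>R x') - w"
  proof -
    have "(1 + a) *\<^sub>R (v - x') = xb + a *\<^sub>R x - (1 + a) *\<^sub>R x' - \<tau> *\<^sub>R w"
      using a0 by (simp add: v \<tau>t scaleR_diff_right)
    moreover have "(v - x') /\<^sub>R \<tau>t = inverse \<tau> *\<^sub>R ((1 + a) *\<^sub>R (v - x'))"
      using a0 \<tau>0 by (simp add: \<tau>t divide_inverse mult.commute)
    ultimately show ?thesis using \<tau>0 by (simp add: scaleR_diff_right)
  qed
  also have "xb + a *\<^sub>R x - (1 + a) *\<^sub>R x' = l *\<^sub>R (\<zeta> - \<zeta>') + a *\<^sub>R (x - x')"
  proof -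
    have "xb + a *\<^sub>R x - (1 + a) *\<^sub>R x' = (xb - x') + a *\<^sub>R (x - x')" by (simp add: algebra_simps)
    also have "xb - x' = l *\<^sub>R (\<zeta> - \<zeta>')" by (subst l\<zeta>') (simp add: xb algebra_simps)
    finally show ?thesis .
  qed
  also have "inverse \<tau> *\<^sub>R \<dots> = (2 * c * k) *\<^sub>R (\<zeta> - \<zeta>') + (c * k) *\<^sub>R (x - x')"
    by (simp only: scaleR_add_right scaleR_scaleR it)
  finally have s: "(v - x') /\<^sub>R \<tau>t = (2 * c * k) *\<^sub>R (\<zeta> - \<zeta>') + (c * k) *\<^sub>R (x - x') - w" (is "_ = ?s") .
  have 1: "g x' + ?s \<bullet> (p - x') + c / 2 * (norm (p - x'))\<^sup>2 \<le> g p"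
    and 2: "g x' + ?s \<bullet> (x - x') + c / 2 * (norm (x - x'))\<^sup>2 \<le> g x"
    using sub p x unfolding s by (auto simp: subgradient_on_def)
  define X X' Z V where "X = x - p" and "X' = x' - p" and "Z = \<zeta> - p" and "V = \<zeta>' - p"
  have V: "V = (k + 1) *\<^sub>R X' - k *\<^sub>R X"
    by (simp add: V_def \<zeta>' k X_def X'_def algebra_simps)
  have s': "?s = (2 * c * k) *\<^sub>R (Z - V) + (c * k) *\<^sub>R (X - X') - w"
    by (simp add: Z_def V_def X_def X'_def)
  \<comment> \<open>With weights 1 and \<open>k\<close> the two test directions add up to minus the
    auxiliary displacement \<open>V\<close>.\<close>
  have "?s \<bullet> (p - x') + k * (?s \<bullet> (x - x')) = ?s \<bullet> ((p - x') + k *\<^sub>R (x - x'))"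
    by (simp only: inner_add_right inner_scaleR_right)
  also have "(p - x') + k *\<^sub>R (x - x') = - V"
    by (simp add: V X_def X'_def algebra_simps)
  also have "?s \<bullet> - V = c * k * (2 * ((V - Z) \<bullet> V)) + c * (k *\<^sub>R (X' - X) \<bullet> V) + w \<bullet> V"
    unfolding s' by (simp add: inner_simps algebra_simps)
  also have "2 * ((V - Z) \<bullet> V) = (norm V)\<^sup>2 + (norm (V - Z))\<^sup>2 - (norm Z)\<^sup>2"
    by (simp add: power2_norm_eq_inner inner_simps inner_commute)
  also have "k *\<^sub>R (X' - X) \<bullet> V = (norm V)\<^sup>2 - X' \<bullet> V"
  proof -
    have "k *\<^sub>R (X' - X) = V - X'" by (simp add: V algebra_simps)
    then show ?thesis by (simp add: power2_norm_eq_inner inner_diff_left)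
  qed
  finally have I: "?s \<bullet> (p - x') + k * (?s \<bullet> (x - x')) =
      c * k * ((norm V)\<^sup>2 + (norm (V - Z))\<^sup>2 - (norm Z)\<^sup>2) + c * ((norm V)\<^sup>2 - X' \<bullet> V) + w \<bullet> V" .
  \<comment> \<open>The first two terms cancel the quadratic gains of the tested inequalities; the
    last two are the quadratic parts of the excesses at \<open>x'\<close> and
    \<open>x\<close>.\<close>
  have Q: "X' \<bullet> V = 1 / 2 * (norm X')\<^sup>2 + k / 2 * (norm (X - X'))\<^sup>2
      + (k + 1) / 2 * (norm X')\<^sup>2 - k / 2 * (norm X)\<^sup>2"
    by (simp add: V power2_norm_eq_inner inner_simps inner_commute[of X' X] field_simps)
  have E: "q \<bullet> V = (k + 1) * (q \<bullet> X') - k * (q \<bullet> X)"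
    by (simp add: V inner_simps)
  have d: "norm (p - x') = norm X'" "x - x' = X - X'" "\<zeta>' - \<zeta> = V - Z"
    by (simp_all add: X_def X'_def V_def Z_def norm_minus_commute)
  have "k * (g x' + ?s \<bullet> (x - x') + c / 2 * (norm (x - x'))\<^sup>2) \<le> k * g x"
    using 2 k0 by simp
  then have "(k + 1) * g x' + (?s \<bullet> (p - x') + k * (?s \<bullet> (x - x')))
      + c / 2 * (norm X')\<^sup>2 + k * c / 2 * (norm (X - X'))\<^sup>2 \<le> g p + k * g x"
    using 1 unfolding d(1) by (simp only: d(2) distrib_left distrib_right) (simp add: algebra_simps)
  then show ?thesis
    unfolding I excess_def inner_add_left d(3) X_def[symmetric] X'_def[symmetric]
      Z_def[symmetric] V_def[symmetric] E Q
    by (simp add: algebra_simps)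
qed

text \<open>The difference of the sides is a quadratic form in \<open>a\<close>, \<open>b\<close>
  whose discriminant is nonpositive.\<close>

lemma young_ineq:
  fixes A B m a b :: real
  assumes "0 < A" "m\<^sup>2 \<le> 4 * A * B"
  shows "m * a * b \<le> A * a\<^sup>2 + B * b\<^sup>2"
proof -
  have "0 \<le> (2 * A * a - m * b)\<^sup>2 + (4 * A * B - m\<^sup>2) * b\<^sup>2" using assms by simp
  also have "\<dots> = 4 * A * (A * a\<^sup>2 + B * b\<^sup>2 - m * a * b)"
    by (simp add: power2_eq_square algebra_simps)
  finally show ?thesis using assms(1) by (simp add: zero_le_mult_iff)
qed

lemma blinfun_inner_le:
  fixes K :: "'a::real_inner \<Rightarrow>\<^sub>L 'b::real_inner"
  assumes "0 < A" "(norm K)\<^sup>2 \<le> 4 * A * B"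
  shows "blinfun_apply K u \<bullet> v \<le> A * (norm u)\<^sup>2 + B * (norm v)\<^sup>2"
proof -
  have "blinfun_apply K u \<bullet> v \<le> norm (blinfun_apply K u) * norm v" by (rule norm_cauchy_schwarz)
  also have "\<dots> \<le> norm K * norm u * norm v" by (intro mult_right_mono norm_blinfun) auto
  also have "\<dots> \<le> A * (norm u)\<^sup>2 + B * (norm v)\<^sup>2" by (rule young_ineq[OF assms])
  finally show ?thesis .
qed

text \<open>The strict bound leaves a positive margin; this is the coercivity of the quadratic part
  of the Lyapunov function.\<close>

lemma blinfun_inner_less:
  fixes K :: "'a::real_inner \<Rightarrow>\<^sub>L 'b::real_inner"
  assumes A: "0 < A" and B: "0 < B" and K: "(norm K)\<^sup>2 < 4 * A * B"
  obtains d where "0 < d" "\<And>u v. d * ((norm u)\<^sup>2 + (norm v)\<^sup>2) \<le> A * (norm u)\<^sup>2 + B * (norm v)\<^sup>2 - blinfun_apply K u \<bullet> v"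
proof -
  \<comment> \<open>This solves \<open>4 * (A - d) * (B - d) = (norm K)\<^sup>2\<close> up to the
    term \<open>4 * d\<^sup>2\<close>, which has the favourable sign.\<close>
  define d where "d = (4 * A * B - (norm K)\<^sup>2) / (4 * (A + B))"
  have d: "0 < d" using assms by (simp add: d_def)
  have "d * (4 * (A + B)) = 4 * A * B - (norm K)\<^sup>2"
    using nonzero_eq_divide_eq[of "4 * (A + B)" d] A B by (auto simp: d_def)
  then have "4 * d * (A + B) = 4 * A * B - (norm K)\<^sup>2" by (simp add: mult.commute mult.left_commute)
  moreover have "4 * (A - d) * (B - d) = 4 * A * B - 4 * d * (A + B) + 4 * d\<^sup>2"
    by (simp add: power2_eq_square algebra_simps)
  ultimately have "(norm K)\<^sup>2 \<le> 4 * (A - d) * (B - d)" by simp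
  moreover have "d < A"
  proof -
    have "4 * A * B - (norm K)\<^sup>2 < A * (4 * (A + B))"
      using A zero_le_power2[of "norm K"] by (simp add: algebra_simps add_nonneg_pos)
    then show ?thesis using A B by (simp add: d_def pos_divide_less_eq)
  qed
  ultimately have "blinfun_apply K u \<bullet> v \<le> (A - d) * (norm u)\<^sup>2 + (B - d) * (norm v)\<^sup>2" for u v
    by (intro blinfun_inner_le) auto
  then show thesis using d by (intro that[of d]) (auto simp: algebra_simps)
qed

text \<open>Weighting the dual inequality by \<open>\<theta> = 1/\<omega>\<close> makes the bilinear terms telescope up to
  \<open>\<langle>K(Z' - Z), W' - W\<rangle>\<close>, which the step-length condition absorbs.\<close>

lemma lyapunov_step:
  fixes K :: "'a::real_inner \<Rightarrow>\<^sub>L 'b::real_inner"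
  assumes pos: "0 < c" "0 < r" "0 < k" "0 < \<theta>" "\<theta> * k \<le> k + 1" and \<omega>: "\<theta> * \<omega> = 1"
    and K: "(norm K)\<^sup>2 \<le> 4 * (c * k) * (\<theta> * r * k)"
    and primal: "c * k * ((norm Z')\<^sup>2 + (norm (Z' - Z))\<^sup>2 - (norm Z)\<^sup>2) + c * (norm Z')\<^sup>2
      + blinfun_apply K Z' \<bullet> W + (k + 1) * g' \<le> k * g"
    and dual: "r * k * ((norm W')\<^sup>2 + (norm (W' - W))\<^sup>2 - (norm W)\<^sup>2) + r * (norm W')\<^sup>2
      - blinfun_apply K (Z' + \<omega> *\<^sub>R (Z' - Z)) \<bullet> W' + (k + 1) * f' \<le> k * f"
    and nonneg: "0 \<le> g'" "0 \<le> f'"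
  shows "\<theta> * (c * k * (norm Z')\<^sup>2 + \<theta> * r * k * (norm W')\<^sup>2 - blinfun_apply K Z' \<bullet> W' + k * g' + \<theta> * k * f')
    \<le> c * k * (norm Z)\<^sup>2 + \<theta> * r * k * (norm W)\<^sup>2 - blinfun_apply K Z \<bullet> W + k * g + \<theta> * k * f"
proof -
  let ?P = "\<lambda>u v. blinfun_apply K u \<bullet> v"
  have y: "?P (Z' - Z) (W' - W) \<le> c * k * (norm (Z' - Z))\<^sup>2 + \<theta> * r * k * (norm (W' - W))\<^sup>2"
    using pos K by (intro blinfun_inner_le) auto
  have dual': "\<theta> * (r * k * ((norm W')\<^sup>2 + (norm (W' - W))\<^sup>2 - (norm W)\<^sup>2) + r * (norm W')\<^sup>2
      - ?P (Z' + \<omega> *\<^sub>R (Z' - Z)) W' + (k + 1) * f') \<le> \<theta> * (k * f)"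
    using dual pos by simp
  \<comment> \<open>Since \<open>\<theta> * \<omega> = 1\<close>, the extrapolation enters with
    weight 1. Combined with \<open>?P Z' W\<close> from the primal side and \<open>?P Z W\<close>
    from the claim, the remainder is the mixed product bounded in \<open>y\<close>.\<close>
  have P: "\<theta> * ?P (Z' + \<omega> *\<^sub>R (Z' - Z)) W' = \<theta> * ?P Z' W' + ?P Z' W' - ?P Z W'"
  proof -
    have "\<theta> * ?P (Z' + \<omega> *\<^sub>R (Z' - Z)) W' = \<theta> * ?P Z' W' + (\<theta> * \<omega>) * (?P Z' W' - ?P Z W')"
      by (simp add: blinfun.bilinear_simps inner_simps algebra_simps)
    then show ?thesis by (simp add: \<omega>)
  qed
  \<comment> \<open>The bound \<open>\<theta> * k \<le> k + 1\<close> serves four times. The extra 1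
    is supplied by \<open>c * (norm Z')\<^sup>2\<close> and \<open>r * (norm W')\<^sup>2\<close> for
    the norms, and by the test against the solution for the excesses.\<close>
  have m1: "\<theta> * k * (c * (norm Z')\<^sup>2) \<le> (k + 1) * (c * (norm Z')\<^sup>2)"
    and m2: "\<theta> * k * (\<theta> * r * (norm W')\<^sup>2) \<le> (k + 1) * (\<theta> * r * (norm W')\<^sup>2)"
    and m3: "\<theta> * k * g' \<le> (k + 1) * g'" and m4: "\<theta> * k * (\<theta> * f') \<le> (k + 1) * (\<theta> * f')"
    using pos nonneg by (intro mult_right_mono; simp)+
  show ?thesis
    using primal dual' y P m1 m2 m3 m4
    by (simp add: blinfun.diff_right inner_simps algebra_simps)
qed

lemma vanishes_linearly_onI:
  assumes q: "0 < q" "q < 1" and b: "\<And>n. 1 \<le> n \<Longrightarrow> 0 \<le> b n \<and> b n \<le> C * q ^ n"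
    and a: "\<And>n. n \<in> I \<Longrightarrow> a n = ereal (b n)"
  shows "vanishes_linearly_on I a"
proof -
  \<comment> \<open>Enlarging the constant covers index 0, where the assumed bound says
    nothing.\<close>
  have "\<bar>a n\<bar> \<le> ereal (max \<bar>C\<bar> \<bar>b 0\<bar> * q ^ n)" if "n \<in> I" for n
  proof (cases "n = 0")
    case False
    then have "\<bar>b n\<bar> \<le> C * q ^ n" using b[of n] by simp
    also have "\<dots> \<le> max \<bar>C\<bar> \<bar>b 0\<bar> * q ^ n" using q by (intro mult_right_mono) auto
    finally show ?thesis using a[OF that] by simp
  qed (use a[OF that] in simp)
  then show ?thesis unfolding vanishes_linearly_on_def
    by (intro exI[of _ "max \<bar>C\<bar> \<bar>b 0\<bar>"] conjI bexI[of _ q]) (use q in auto)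
qed

text \<open>The recursion starts at 1 because \<open>x 0\<close> may lie outside the domain of
  \<open>G\<close>; the factor \<open>\<theta>\<close> in front compensates the shift of the
  index.\<close>

lemma geometric_decay:
  fixes V :: "nat \<Rightarrow> real"
  assumes \<theta>: "0 < \<theta>" and step: "\<And>n. 1 \<le> n \<Longrightarrow> \<theta> * V (n + 1) \<le> V n" and n: "1 \<le> n"
  shows "V n \<le> \<theta> * V 1 * inverse \<theta> ^ n"
  using n
proof (induction n rule: dec_induct)
  case base
  then show ?case using \<theta> by (simp add: field_simps)
next
  case (step n)
  have "V (n + 1) \<le> inverse \<theta> * V n"
    using assms(2)[of n] step \<theta> by (simp add: field_simps)
  also have "\<dots> \<le> inverse \<theta> * (\<theta> * V 1 * inverse \<theta> ^ n)"
    using step \<theta> by (intro mult_left_mono) auto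
  finally show ?case by (simp add: mult_ac)
qed

text \<open>Finiteness reduces everything to real arithmetic. The adjoint matches the bilinear
  terms, and the two copies of \<open>q \<bullet> K p\<close> cancel.\<close>

lemma adjusted_gap_eq_excess:
  fixes K :: "'a::{real_inner,complete_space} \<Rightarrow>\<^sub>L 'b::real_inner"
  assumes "\<bar>G u\<bar> \<noteq> \<infinity>" "\<bar>G p\<bar> \<noteq> \<infinity>" "\<bar>Fs v\<bar> \<noteq> \<infinity>" "\<bar>Fs q\<bar> \<noteq> \<infinity>"
  shows "adjusted_gap G Fs K \<gamma> \<rho> (u, v) (p, q) =
    ereal (excess \<gamma> (\<lambda>x. real_of_ereal (G x)) p (- adjoint (blinfun_apply K) q) u
      + excess \<rho> (\<lambda>y. real_of_ereal (Fs y)) q (blinfun_apply K p) v)"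
proof -
  obtain a b c d where "G u = ereal a" "G p = ereal b" "Fs v = ereal c" "Fs q = ereal d"
    using assms by (auto simp: ereal_infinity_cases)
  then show ?thesis
    using inner_adjoint_blinfun[of K u q] inner_adjoint_blinfun[of K p q]
    by (simp add: adjusted_gap_def adjusted_def excess_def inner_diff_right inner_commute
        [of _ "adjoint _ _"] inner_commute[of q] inner_commute[of v])
qed

text \<open>In the sum of the four subgradient inequalities the function values and the bilinear
  terms cancel, so only the strong convexity terms remain.\<close>

lemma saddle_point_unique:
  fixes K :: "'a::{real_inner,complete_space} \<Rightarrow>\<^sub>L 'b::real_inner"
  assumes c: "0 < c" and r: "0 < r"
    and 1: "subgradient_on c D g p1 (- adjoint (blinfun_apply K) q1)"
      "subgradient_on r E f q1 (blinfun_apply K p1)"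
    and 2: "subgradient_on c D g p2 (- adjoint (blinfun_apply K) q2)"
      "subgradient_on r E f q2 (blinfun_apply K p2)"
  shows "p1 = p2 \<and> q1 = q2"
proof -
  let ?A = "adjoint (blinfun_apply K)"
  have "g p1 + - ?A q1 \<bullet> (p2 - p1) + c / 2 * (norm (p2 - p1))\<^sup>2 \<le> g p2"
    "g p2 + - ?A q2 \<bullet> (p1 - p2) + c / 2 * (norm (p1 - p2))\<^sup>2 \<le> g p1"
    "f q1 + blinfun_apply K p1 \<bullet> (q2 - q1) + r / 2 * (norm (q2 - q1))\<^sup>2 \<le> f q2"
    "f q2 + blinfun_apply K p2 \<bullet> (q1 - q2) + r / 2 * (norm (q1 - q2))\<^sup>2 \<le> f q1"
    using 1 2 by (auto simp: subgradient_on_def)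
  moreover have "- ?A q1 \<bullet> (p2 - p1) + - ?A q2 \<bullet> (p1 - p2)
      + blinfun_apply K p1 \<bullet> (q2 - q1) + blinfun_apply K p2 \<bullet> (q1 - q2) = 0"
    by (simp add: inner_diff_right inner_diff_left inner_adjoint_blinfun inner_commute[of "?A _"])
  ultimately have "c * (norm (p1 - p2))\<^sup>2 + r * (norm (q1 - q2))\<^sup>2 \<le> 0"
    by (simp add: norm_minus_commute[of p2] norm_minus_commute[of q2])
  moreover have "0 \<le> c * (norm (p1 - p2))\<^sup>2" "0 \<le> r * (norm (q1 - q2))\<^sup>2" using c r by auto
  ultimately have "c * (norm (p1 - p2))\<^sup>2 = 0" "r * (norm (q1 - q2))\<^sup>2 = 0" by linarith+
  with c r show ?thesis by simp
qed

theorem theorem4p8: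
  fixes G :: "'a::{real_inner,complete_space} \<Rightarrow> ereal"
    and F :: "'b::{real_inner,complete_space} \<Rightarrow> ereal"
    and K :: "'a \<Rightarrow>\<^sub>L 'b"
    and \<gamma> \<rho> l \<epsilon> :: real
    and \<tau> \<sigma> lam \<mu> \<omega> :: "nat \<Rightarrow> real"
    and x xb xt :: "nat \<Rightarrow> 'a"
    and y yb yt :: "nat \<Rightarrow> 'b"
    and z :: "nat \<Rightarrow> 'a \<times> 'b"
  assumes "convex_fun G" "proper_fun G" "lsc_fun G"
    and "convex_fun F" "proper_fun F" "lsc_fun F"
    and "strongly_convex_fun \<gamma> G" "strongly_convex_fun \<rho> (fenchel_conjugate F)"
    and "\<gamma> > 0" "\<rho> > 0"
    and "0 < l" "l < 1" "0 \<le> \<epsilon>" "\<epsilon> < 1"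
    and "(norm K)\<^sup>2 < 4 * \<gamma> * \<rho> * (inverse l - \<epsilon>) * (inverse l - 1)"
    and "\<And>i. \<tau> i = l\<^sup>2 / (2 * \<gamma> * (1 - l))"
    and "\<And>i. \<omega> i = (inverse l - 1) / (inverse l - \<epsilon>)"
    and "\<And>i. \<sigma> i = l\<^sup>2 / (2 * \<rho> * (1 - l))"
    and "\<And>i. lam i = l" "\<And>i. \<mu> i = l"
    and "ic_pdps G (fenchel_conjugate F) K \<gamma> \<rho> \<tau> \<sigma> lam \<mu> \<omega> x xb xt y yb yt"
    and "auxiliary_sequence lam \<mu> x y z"
  shows "\<exists>uh. solution_set G (fenchel_conjugate F) K = {uh} \<and>
           vanishes_linearly_on {N. N \<ge> 1 \<or> G (x 0) < \<infinity>}
             (\<lambda>N. adjusted_gap G (fenchel_conjugate F) K \<gamma> \<rho> (x N, y N) uh) \<and>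
           vanishes_linearly_on UNIV (\<lambda>N. ereal ((norm (z N - uh))\<^sup>2))"
proof -

  \<comment> \<open>Constants and their relations\<close>
  let ?Fs = "fenchel_conjugate F" and ?A = "adjoint (blinfun_apply K)"
  define D E where "D = finite_dom G" and "E = finite_dom ?Fs"
  define g f where "g = (\<lambda>u. real_of_ereal (G u))" and "f = (\<lambda>v. real_of_ereal (?Fs v))"
  note gf = D_def E_def g_def f_def
  note pos = \<open>\<gamma> > 0\<close> \<open>\<rho> > 0\<close> \<open>0 < l\<close> \<open>l < 1\<close>
  define k where "k = inverse l - 1"
  \<comment> \<open>The reciprocal of the constant value of \<open>\<omega>\<close>; it exceeds 1
    because \<open>\<epsilon> < 1\<close>, and its inverse is the rate obtained.\<close>
  define \<theta> where "\<theta> = (inverse l - \<epsilon>) / k"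
  define \<tau>0 \<sigma>0 where "\<tau>0 = l\<^sup>2 / (2 * \<gamma> * (1 - l))" and "\<sigma>0 = l\<^sup>2 / (2 * \<rho> * (1 - l))"
  define a b where "a = \<gamma> * \<tau>0 * k" and "b = \<rho> * \<sigma>0 * k"
  have k0: "0 < k" using pos by (simp add: k_def one_less_inverse)
  have \<theta>1: "1 < \<theta>" using k0 \<open>\<epsilon> < 1\<close> by (simp add: \<theta>_def k_def)
  have \<theta>k: "\<theta> * k = inverse l - \<epsilon>" "\<theta> * k \<le> k + 1"
    using k0 \<open>0 \<le> \<epsilon>\<close> by (simp_all add: \<theta>_def) (simp add: k_def)
  have \<omega>: "k / (inverse l - \<epsilon>) = inverse \<theta>" by (simp add: \<theta>_def)
  have ab0: "0 < 1 + a" "0 < 1 + b" "0 < \<tau>0" "0 < \<sigma>0"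
    using pos k0 by (simp_all add: a_def b_def \<tau>0_def \<sigma>0_def add_pos_pos)
  \<comment> \<open>In terms of \<open>\<theta>\<close> and \<open>k\<close> the bound on
    \<open>K\<close> becomes the discriminant condition for the quadratic part of the Lyapunov
    function.\<close>
  have "(norm K)\<^sup>2 < 4 * \<gamma> * \<rho> * (\<theta> * k) * k"
    using assms(15) unfolding \<theta>k(1) unfolding k_def .
  then have normK: "(norm K)\<^sup>2 < 4 * (\<gamma> * k) * (\<theta> * \<rho> * k)"
    by (simp add: mult_ac)

  \<comment> \<open>Real-valued forms of \<open>G\<close> and the conjugate of
    \<open>F\<close>\<close>
  have finG: "G u \<noteq> -\<infinity>" and finF: "?Fs v \<noteq> -\<infinity>" for u v
    using \<open>proper_fun G\<close> fenchel_conjugate_neq_MInfty[OF \<open>proper_fun F\<close>]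
    by (auto simp: proper_fun_def)
  have scg: "strongly_convex_on \<gamma> D g" and scf: "strongly_convex_on \<rho> E f"
    unfolding gf using assms(7,8) finG finF by (auto intro: strongly_convex_on_real_of_ereal)
  have clg: "closed (epigraph_on D g)" and clf: "closed (epigraph_on E f)"
    unfolding gf epigraph_on_real_of_ereal[of G, OF finG] epigraph_on_real_of_ereal[of ?Fs, OF finF]
    using closed_epigraph_lsc[OF \<open>lsc_fun G\<close>] closed_epigraph_fenchel_conjugate[of F] \<open>proper_fun F\<close>
    by (auto simp: proper_fun_def)
  note alg = assms(21)[unfolded ic_pdps_def Let_def assms(16-20), folded k_def \<tau>0_def \<sigma>0_def,
      folded a_def b_def]
  \<comment> \<open>The initialisation places only \<open>y 0\<close> in the domain;
    \<open>G (x 0)\<close> may be infinite.\<close>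
  have y0: "y 0 \<in> E" using alg by (auto simp: subdiff_def E_def)
  have neD: "D \<noteq> {}" unfolding D_def using \<open>proper_fun G\<close> finG
    unfolding proper_fun_def by (metis (mono_tags) ereal_infinity_cases empty_iff mem_Collect_eq)
  have neE: "E \<noteq> {}" using y0 by blast

  \<comment> \<open>Existence and uniqueness of the saddle point\<close>
  have sol: "(p, q) \<in> solution_set G ?Fs K \<longleftrightarrow>
      subgradient_on \<gamma> D g p (- ?A q) \<and> subgradient_on \<rho> E f q (blinfun_apply K p)" for p q
    using mem_subdiff_iff[of \<gamma> G] mem_subdiff_iff[of \<rho> ?Fs] scg scf finG finF pos
    unfolding gf by (simp add: solution_set_def)
  obtain p q where p: "subgradient_on \<gamma> D g p (- ?A q)" and q: "subgradient_on \<rho> E f q (blinfun_apply K p)"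
    using saddle_point_exists[OF scg \<open>\<gamma> > 0\<close> clg neD scf \<open>\<rho> > 0\<close> clf neE] by blast
  have "solution_set G ?Fs K = {(p, q)}"
  proof -
    have "u = (p, q)" if "u \<in> solution_set G ?Fs K" for u
    proof -
      obtain p' q' where u: "u = (p', q')" by (cases u)
      with that sol[of p' q'] saddle_point_unique[OF \<open>\<gamma> > 0\<close> \<open>\<rho> > 0\<close> _ _ p q] show ?thesis by auto
    qed
    then show ?thesis using p q sol[of p q] by blast
  qed
  moreover have pD: "p \<in> D" and qE: "q \<in> E" using p q by (auto simp: subgradient_on_def)

  \<comment> \<open>Tilded and barred sequences in terms of the auxiliary sequence\<close>
  define \<zeta> \<eta> where "\<zeta> i = fst (z i)" and "\<eta> i = snd (z i)" for i
  have \<zeta>0: "\<zeta> 0 = x 0" "\<eta> 0 = y 0"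
    and \<zeta>: "\<And>i. \<zeta> (i + 1) = inverse l *\<^sub>R x (i + 1) - k *\<^sub>R x i"
    and \<eta>: "\<And>i. \<eta> (i + 1) = inverse l *\<^sub>R y (i + 1) - k *\<^sub>R y i"
    using assms(22) unfolding auxiliary_sequence_def assms(19,20)
    by (auto simp: \<zeta>_def \<eta>_def k_def)
  have lk: "l * k = 1 - l" using pos by (simp add: k_def algebra_simps)
  have xt: "xt i = \<zeta> i" for i
  proof (cases i)
    case (Suc j)
    have "xt (j + 1) = x (j + 1) + k *\<^sub>R (x (j + 1) - x j)" using alg by blast
    also have "\<dots> = \<zeta> (j + 1)"
      unfolding \<zeta> by (simp add: k_def algebra_simps)
    finally show ?thesis by (simp add: Suc)
  qed (use alg \<zeta>0 in simp)
  have yt: "yt i = \<eta> i" for i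
  proof (cases i)
    case (Suc j)
    have "yt (j + 1) = y (j + 1) + k *\<^sub>R (y (j + 1) - y j)" using alg by blast
    also have "\<dots> = \<eta> (j + 1)"
      unfolding \<eta> by (simp add: k_def algebra_simps)
    finally show ?thesis by (simp add: Suc)
  qed (use alg \<zeta>0 in simp)
  \<comment> \<open>Since \<open>l * k = 1 - l\<close>, the barred points take the form that
    \<open>inertial_prox_step\<close> expects.\<close>
  have xb: "xb i = l *\<^sub>R \<zeta> i + (1 - l) *\<^sub>R x i" for i
  proof (cases i)
    case (Suc j)
    have "xb (j + 1) = x (j + 1) + (l * k) *\<^sub>R (x (j + 1) - x j)" using alg by blast
    also have "\<dots> = l *\<^sub>R \<zeta> (j + 1) + (1 - l) *\<^sub>R x (j + 1)"
      using pos unfolding \<zeta> scaleR_diff_right scaleR_scaleR lk by (simp add: algebra_simps)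
    finally show ?thesis by (simp add: Suc)
  qed (use alg \<zeta>0 in \<open>simp add: algebra_simps\<close>)
  have yb: "yb i = l *\<^sub>R \<eta> i + (1 - l) *\<^sub>R y i" for i
  proof (cases i)
    case (Suc j)
    have "yb (j + 1) = y (j + 1) + (l * k) *\<^sub>R (y (j + 1) - y j)" using alg by blast
    also have "\<dots> = l *\<^sub>R \<eta> (j + 1) + (1 - l) *\<^sub>R y (j + 1)"
      using pos unfolding \<eta> scaleR_diff_right scaleR_scaleR lk by (simp add: algebra_simps)
    finally show ?thesis by (simp add: Suc)
  qed (use alg \<zeta>0 in \<open>simp add: algebra_simps\<close>)

  \<comment> \<open>Proximal inclusions for the iterates\<close>
  define vx where "vx i = (xb i + a *\<^sub>R x i) /\<^sub>R (1 + a) - (\<tau>0 / (1 + a)) *\<^sub>R ?A (\<eta> i)" for i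
  \<comment> \<open>The sign gives the dual update the shape of the primal one, with
    \<open>wy i\<close> in the role of \<open>?A (\<eta> i)\<close>.\<close>
  define wy where "wy i = - blinfun_apply K (\<zeta> (i + 1) + inverse \<theta> *\<^sub>R (\<zeta> (i + 1) - \<zeta> i))" for i
  define vy where "vy i = (yb i + b *\<^sub>R y i) /\<^sub>R (1 + b) - (\<sigma>0 / (1 + b)) *\<^sub>R wy i" for i
  have "x (i + 1) = prox (\<tau>0 / (1 + a)) G (vx i)" for i
    using alg by (simp add: vx_def yt)
  then have subx: "subgradient_on \<gamma> D g (x (i + 1)) ((vx i - x (i + 1)) /\<^sub>R (\<tau>0 / (1 + a)))" for i
    using prox_subgradient_on[of \<gamma> G "\<tau>0 / (1 + a)"] scg clg neD finG ab0 pos unfolding gf by simp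
  have "y (i + 1) = prox (\<sigma>0 / (1 + b)) ?Fs ((yb i + b *\<^sub>R y i) /\<^sub>R (1 + b) + (\<sigma>0 / (1 + b)) *\<^sub>R
      blinfun_apply K (xt (i + 1) + (k / (inverse l - \<epsilon>)) *\<^sub>R (xt (i + 1) - xt i)))" for i
    using alg by blast
  then have "y (i + 1) = prox (\<sigma>0 / (1 + b)) ?Fs (vy i)" for i
    unfolding \<omega> xt by (simp add: vy_def wy_def)
  then have suby: "subgradient_on \<rho> E f (y (i + 1)) ((vy i - y (i + 1)) /\<^sub>R (\<sigma>0 / (1 + b)))" for i
    using prox_subgradient_on[of \<rho> ?Fs "\<sigma>0 / (1 + b)"] scf clf neE finF ab0 pos unfolding gf by simp
  have xD: "x n \<in> D" if "1 \<le> n" for n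
    using subx[of "n - 1"] that by (simp add: subgradient_on_def)
  have yE: "y n \<in> E" for n
    using suby[of "n - 1"] y0 by (cases n) (simp_all add: subgradient_on_def)

  \<comment> \<open>Decay and coercivity of the Lyapunov function\<close>
  define ex ey where "ex n = excess \<gamma> g p (- ?A q) (x n)"
    and "ey n = excess \<rho> f q (blinfun_apply K p) (y n)" for n
  have ex0: "0 \<le> ex n" if "1 \<le> n" for n
    unfolding ex_def by (rule excess_nonneg[OF p xD[OF that]])
  have ey0: "0 \<le> ey n" for n
    unfolding ey_def by (rule excess_nonneg[OF q yE])
  define V where "V n = \<gamma> * k * (norm (\<zeta> n - p))\<^sup>2 + \<theta> * \<rho> * k * (norm (\<eta> n - q))\<^sup>2
    - blinfun_apply K (\<zeta> n - p) \<bullet> (\<eta> n - q) + k * ex n + \<theta> * k * ey n" for n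
  \<comment> \<open>Index 0 is left out since the old iterate \<open>x n\<close> serves as a test
    point and has to lie in \<open>D\<close>.\<close>
  have "\<theta> * V (n + 1) \<le> V n" if n: "1 \<le> n" for n
    unfolding V_def
  proof (rule lyapunov_step[where \<omega> = "inverse \<theta>"])
    have "(?A (\<eta> n) + - ?A q) \<bullet> (\<zeta> (n + 1) - p) = blinfun_apply K (\<zeta> (n + 1) - p) \<bullet> (\<eta> n - q)"
      by (simp add: inner_diff_right inner_adjoint_blinfun inner_diff_left inner_commute[of "?A _"])
    with inertial_prox_step[OF \<open>\<gamma> > 0\<close> \<open>0 < l\<close> \<open>l < 1\<close> k_def \<tau>0_def a_def refl xb \<zeta> vx_def subx pD xD[OF n],
        of "- ?A q"]
    show "\<gamma> * k * ((norm (\<zeta> (n + 1) - p))\<^sup>2 + (norm (\<zeta> (n + 1) - p - (\<zeta> n - p)))\<^sup>2 - (norm (\<zeta> n - p))\<^sup>2)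
      + \<gamma> * (norm (\<zeta> (n + 1) - p))\<^sup>2 + blinfun_apply K (\<zeta> (n + 1) - p) \<bullet> (\<eta> n - q)
      + (k + 1) * ex (n + 1) \<le> k * ex n"
      by (simp add: ex_def)
    have "wy n + blinfun_apply K p = - blinfun_apply K (\<zeta> (n + 1) - p
        + inverse \<theta> *\<^sub>R (\<zeta> (n + 1) - p - (\<zeta> n - p)))"
      by (simp add: wy_def blinfun.bilinear_simps)
    with inertial_prox_step[OF \<open>\<rho> > 0\<close> \<open>0 < l\<close> \<open>l < 1\<close> k_def \<sigma>0_def b_def refl yb \<eta> vy_def suby qE yE,
        of n "blinfun_apply K p"]
    show "\<rho> * k * ((norm (\<eta> (n + 1) - q))\<^sup>2 + (norm (\<eta> (n + 1) - q - (\<eta> n - q)))\<^sup>2 - (norm (\<eta> n - q))\<^sup>2)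
      + \<rho> * (norm (\<eta> (n + 1) - q))\<^sup>2
      - blinfun_apply K (\<zeta> (n + 1) - p + inverse \<theta> *\<^sub>R (\<zeta> (n + 1) - p - (\<zeta> n - p))) \<bullet> (\<eta> (n + 1) - q)
      + (k + 1) * ey (n + 1) \<le> k * ey n"
      by (simp only: ey_def inner_minus_left) simp
  qed (use pos k0 \<theta>1 \<theta>k normK ex0 ey0 in auto)
  then have V: "V n \<le> \<theta> * V 1 * inverse \<theta> ^ n" if "1 \<le> n" for n
    using geometric_decay[of \<theta> V n] that \<theta>1 by simp
  obtain d where d: "0 < d" and dV: "\<And>u v. d * ((norm u)\<^sup>2 + (norm v)\<^sup>2)
      \<le> \<gamma> * k * (norm u)\<^sup>2 + \<theta> * \<rho> * k * (norm v)\<^sup>2 - blinfun_apply K u \<bullet> v"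
    using blinfun_inner_less[OF _ _ normK] pos k0 \<theta>1 by auto
  \<comment> \<open>The surplus factor \<open>\<theta>\<close> on \<open>ey n\<close> is dropped so
    that the gap \<open>ex n + ey n\<close> appears; coercivity bounds the quadratic part.\<close>
  have low: "d * ((norm (\<zeta> n - p))\<^sup>2 + (norm (\<eta> n - q))\<^sup>2) + k * (ex n + ey n) \<le> V n" for n
  proof -
    have "1 * (k * ey n) \<le> \<theta> * (k * ey n)" using k0 \<theta>1 ey0[of n] by (intro mult_right_mono) auto
    then show ?thesis using dV[of "\<zeta> n - p" "\<eta> n - q"] by (simp add: V_def algebra_simps)
  qed
  have rate: "0 < inverse \<theta>" "inverse \<theta> < 1" using \<theta>1 by (simp_all add: inverse_less_1_iff)

  \<comment> \<open>Linear rates for the gap and the auxiliary sequence\<close>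
  have "vanishes_linearly_on {N. N \<ge> 1 \<or> G (x 0) < \<infinity>} (\<lambda>N. adjusted_gap G ?Fs K \<gamma> \<rho> (x N, y N) (p, q))"
  proof (rule vanishes_linearly_onI[OF rate, of "\<lambda>n. ex n + ey n" "\<theta> * V 1 / k"])
    fix n :: nat assume n: "1 \<le> n"
    have "0 \<le> d * ((norm (\<zeta> n - p))\<^sup>2 + (norm (\<eta> n - q))\<^sup>2)" using d by simp
    then have "k * (ex n + ey n) \<le> \<theta> * V 1 * inverse \<theta> ^ n" using low[of n] V[OF n] by linarith
    then have "ex n + ey n \<le> \<theta> * V 1 * inverse \<theta> ^ n / k" using k0 by (simp add: pos_le_divide_eq mult.commute)
    then show "0 \<le> ex n + ey n \<and> ex n + ey n \<le> \<theta> * V 1 / k * inverse \<theta> ^ n"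
      using ex0[OF n] ey0[of n] by simp
  next
    fix n :: nat assume n: "n \<in> {N. N \<ge> 1 \<or> G (x 0) < \<infinity>}"
    \<comment> \<open>Index 0 occurs here only if \<open>G (x 0)\<close> is finite.\<close>
    have "x n \<in> D"
    proof (cases "n = 0")
      case True
      with n finG[of "x 0"] show ?thesis by (auto simp: D_def)
    qed (use xD in auto)
    with pD qE yE[of n] show "adjusted_gap G ?Fs K \<gamma> \<rho> (x n, y n) (p, q) = ereal (ex n + ey n)"
      unfolding gf ex_def ey_def by (simp add: adjusted_gap_eq_excess)
  qed
  moreover have "vanishes_linearly_on UNIV (\<lambda>N. ereal ((norm (z N - (p, q)))\<^sup>2))"
  proof (rule vanishes_linearly_onI[OF rate _ refl, of _ "\<theta> * V 1 / d"])
    fix n :: nat assume n: "1 \<le> n"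
    have "z n - (p, q) = (\<zeta> n - p, \<eta> n - q)" by (simp add: \<zeta>_def \<eta>_def minus_prod_def)
    then have N: "(norm (z n - (p, q)))\<^sup>2 = (norm (\<zeta> n - p))\<^sup>2 + (norm (\<eta> n - q))\<^sup>2" by (simp add: norm_Pair)
    have "0 \<le> k * (ex n + ey n)" using k0 ex0[OF n] ey0[of n] by simp
    then have "d * (norm (z n - (p, q)))\<^sup>2 \<le> \<theta> * V 1 * inverse \<theta> ^ n"
      using low[of n] V[OF n] unfolding N by linarith
    then have "(norm (z n - (p, q)))\<^sup>2 \<le> \<theta> * V 1 * inverse \<theta> ^ n / d"
      using d by (simp add: pos_le_divide_eq mult.commute)
    then show "0 \<le> (norm (z n - (p, q)))\<^sup>2 \<and> (norm (z n - (p, q)))\<^sup>2 \<le> \<theta> * V 1 / d * inverse \<theta> ^ n"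
      by simp
  qed
  ultimately show ?thesis by blast
qed

end
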